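(* Let $k\ge0$ be an integer such that the $k$th Hopf bifurcation of (1) is supercritical, i.e. $C<H(k)B^2$. Then for all sufficiently small $\eta>0$, the minimal period of the periodic solution on the $k$th Hopf branch at parameter $\mu_k+\eta$ satisfies $$T^k_\eta\ \ge\ \frac{4}{4k+1+\frac{2\eta}{\pi}}.$$
   Context: Consider the scalar delay differential equation (1) $x'(t)=-\mu f(x(t-1))$, with real parameter $\mu$ and phase space $C([-1,0],\mathbb R)$. Here $f:\mathbb R\to\mathbb R$ is $C^3$ with $f(0)=0$ and $f'(0)=1$, so that $f(\xi)=\xi+B\xi^2+C\xi^3+o(\xi^3)$ with $B=f''(0)/2$ and $C=f'''(0)/6$. For $k\in\mathbb Z$ let $\mu_k=\frac{(4k+1)\pi}{2}$ and $H(k)=\frac{22(4k+1)\pi-8}{15(4k+1)\pi}$. The $k$th Hopf bifurcation (at $\mu_k$) is supercritical if $C<H(k)B^2$ and subcritical if $C>H(k)B^2$; it is called nondegenerate if $C\ne H(k)B^2$. Supercritical means the bifurcating small periodic orbits are stable within the center manifold; subcritical means they are unstable there. Hopf branch notation, for $k\ge0$ with a nondegenerate $k$th bifurcation: put $\delta_k=1$ if it is supercritical and $\delta_k=-1$ if it is subcritical. There are $\eta_k>0$ and a family of nonconstant periodic solutions $p^k_\eta$, $\eta\in(0,\eta_k)$, of (1) with parameter $\mu=\mu_k+\delta_k\eta$. These bifurcate from $0$ at $\mu_k$ (amplitude $\to0$ as $\eta\to0$), and they are locally unique up to time translation. $T^k_\eta$ denotes the minimal period of $p^k_\eta$, and $T^k_\eta\to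 T^k_0:=\frac{4}{4k+1}$ as $\eta\to0$. *)

theory Defs
  imports "HOL-Analysis.Analysis"
begin

definition C3 :: "(real \<Rightarrow> real) \<Rightarrow> bool" where
  "C3 f \<longleftrightarrow>
     (\<forall>x. (f has_real_derivative deriv f x) (at x)) \<and>
     (\<forall>x. (deriv f has_real_derivative (deriv ^^ 2) f x) (at x)) \<and>
     (\<forall>x. ((deriv ^^ 2) f has_real_derivative (deriv ^^ 3) f x) (at x)) \<and>
     continuous_on UNIV ((deriv ^^ 3) f)"

definition coefB :: "(real \<Rightarrow> real) \<Rightarrow> real" where
  "coefB f = (deriv ^^ 2) f 0 / 2"

definition coefC :: "(real \<Rightarrow> real) \<Rightarrow> real" where
  "coefC f = (deriv ^^ 3) f 0 / 6"

definition mu_k :: "nat \<Rightarrow> real" where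
  "mu_k k = (4 * real k + 1) * pi / 2"

definition H :: "nat \<Rightarrow> real" where
  "H k = (22 * (4 * real k + 1) * pi - 8) / (15 * (4 * real k + 1) * pi)"

definition is_solution :: "(real \<Rightarrow> real) \<Rightarrow> real \<Rightarrow> (real \<Rightarrow> real) \<Rightarrow> bool" where
  "is_solution f \<mu> x \<longleftrightarrow> (\<forall>t. (x has_real_derivative (- \<mu> * f (x (t - 1)))) (at t))"

definition minimal_period :: "(real \<Rightarrow> real) \<Rightarrow> real \<Rightarrow> bool" where
  "minimal_period x T \<longleftrightarrow> T > 0 \<and> (\<forall>t. x (t + T) = x t) \<and>
     (\<forall>S. 0 < S \<and> S < T \<longrightarrow> \<not> (\<forall>t. x (t + S) = x t))"

end

theory Submission
  imports Defs "HOL-Library.Periodic_Fun"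
begin

text \<open>
  Put \<open>\<omega> = 2\<pi>/T\<close>. The rescaled orbit \<open>u(\<theta>) = p(\<theta>/\<omega>)\<close> is \<open>2\<pi>\<close>-periodic and satisfies
  \<open>u'(\<theta>) = -l f(u(\<theta> - s))\<close> with \<open>l = \<mu>/\<omega>\<close> close to \<open>1\<close> and \<open>s = \<omega> - 2\<pi>k\<close> close to \<open>\<pi>/2\<close>, so \<open>k\<close>
  disappears, and the bound on the period says \<open>l \<ge> 1\<close>. Comparing the moduli of the first Fourier
  modes of both sides gives \<open>A\<^sup>2 = l\<^sup>2 (X\<^sup>2 + Z\<^sup>2)\<close>, where, after a translation, \<open>u\<close> has first mode
  \<open>A cos \<theta>\<close> and \<open>f \<circ> u\<close> has first mode \<open>X cos \<theta> + Z sin \<theta>\<close>.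
  Off the first mode the linear equation \<open>y'(\<theta>) = -y(\<theta> - \<pi>/2)\<close> is boundedly invertible in the sup norm
  (it becomes an ODE system for the four quarter-period translates of \<open>y\<close>), hence
  \<open>u = A cos \<theta> + A\<^sup>2 B q(\<theta>) + o(A\<^sup>2)\<close> with an explicit \<open>q\<close>. This yields
  \<open>X = A - (11 B\<^sup>2/10 - 3 C/4) A\<^sup>3 + o(A\<^sup>3)\<close> and \<open>Z = O(A\<^sup>3)\<close>, so \<open>X\<^sup>2 + Z\<^sup>2 < A\<^sup>2\<close> as soon as
  \<open>C < 22 B\<^sup>2/15\<close>, which follows from supercriticality because \<open>H(k) < 22/15\<close>.
\<close>

section \<open>Periodic functions and their first Fourier mode\<close>

definition cont_periodic :: "(real \<Rightarrow> real) \<Rightarrow> bool" where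
  "cont_periodic v \<longleftrightarrow> continuous_on UNIV v \<and> (\<forall>t. v (t + 2 * pi) = v t)"

text \<open>As a function of the phase \<open>a\<close>, \<open>first_mode a v\<close> is the projection of \<open>v\<close> to the span of
  \<open>cos\<close> and \<open>sin\<close>; keeping the phase as a parameter turns delays and derivatives into shifts of \<open>a\<close>.\<close>

definition first_mode :: "real \<Rightarrow> (real \<Rightarrow> real) \<Rightarrow> real" where
  "first_mode a v = integral {0..2 * pi} (\<lambda>t. v t * cos (t - a)) / pi"

lemma periodic_shift_int:
  fixes v :: "real \<Rightarrow> 'a" and p :: real
  assumes "\<And>t. v (t + p) = v t"
  shows "v (t + of_int n * p) = v t"
proof -
  interpret periodic_fun_simple v p by standard (use assms in auto)
  show ?thesis by (rule plus_of_int)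
qed

lemma cont_periodic_shift:
  assumes "cont_periodic v" shows "cont_periodic (\<lambda>t. v (t + c))"
proof -
  have "v (t + 2 * pi + c) = v (t + c)" for t
    using assms[unfolded cont_periodic_def, THEN conjunct2, rule_format, of "t + c"]
    by (simp add: algebra_simps)
  moreover have "continuous_on UNIV (\<lambda>t. v (t + c))"
    using assms continuous_on_compose2[of UNIV v UNIV "\<lambda>t. t + c"]
    unfolding cont_periodic_def by (simp add: continuous_on_add)
  ultimately show ?thesis unfolding cont_periodic_def by blast
qed

lemma cont_periodic_shift':
  assumes "cont_periodic v" shows "cont_periodic (\<lambda>t. v (t - c))"
  using cont_periodic_shift[OF assms, of "-c"] by simp

lemma cont_periodic_arith:
  assumes "cont_periodic v" "cont_periodic w"
  shows "cont_periodic (\<lambda>t. v t + w t)" "cont_periodic (\<lambda>t. v t - w t)"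
    "cont_periodic (\<lambda>t. v t * w t)"
  using assms unfolding cont_periodic_def
  by (auto intro!: continuous_on_add continuous_on_diff continuous_on_mult)

lemma cont_periodic_simple:
  "cont_periodic (\<lambda>t. c)" "cont_periodic sin" "cont_periodic cos"
  "cont_periodic (\<lambda>t. sin (2 * t))" "cont_periodic (\<lambda>t. cos (2 * t))"
proof -
  have "continuous_on UNIV (\<lambda>t::real. c)" "continuous_on UNIV (sin :: real \<Rightarrow> real)"
    "continuous_on UNIV (cos :: real \<Rightarrow> real)"
    "continuous_on UNIV (\<lambda>t::real. sin (2 * t))" "continuous_on UNIV (\<lambda>t::real. cos (2 * t))"
    by (intro continuous_intros)+
  then show "cont_periodic (\<lambda>t. c)" "cont_periodic sin" "cont_periodic cos"
    "cont_periodic (\<lambda>t. sin (2 * t))" "cont_periodic (\<lambda>t. cos (2 * t))"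
    unfolding cont_periodic_def by (simp_all add: distrib_left sin_add cos_add)
qed

lemmas cont_periodic_intros = cont_periodic_arith cont_periodic_simple cont_periodic_shift'

lemma cont_periodic_compose:
  assumes "cont_periodic v" "continuous_on UNIV f" shows "cont_periodic (\<lambda>t. f (v t))"
  using assms continuous_on_compose2[of UNIV f UNIV v] unfolding cont_periodic_def by auto

lemma cont_periodic_integrable:
  assumes "cont_periodic v" shows "v integrable_on {a..b}"
  using assms unfolding cont_periodic_def
  by (meson continuous_on_subset integrable_continuous_real subset_UNIV)

lemma cont_periodic_reduce:
  assumes "cont_periodic v" obtains s where "s \<in> {0..2 * pi}" "v s = v t"
proof
  define n where "n = \<lfloor>t / (2 * pi)\<rfloor>"
  have "of_int n \<le> t / (2 * pi)" "t / (2 * pi) < of_int n + 1"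
    unfolding n_def by linarith+
  then have "of_int n * (2 * pi) \<le> t" "t < of_int n * (2 * pi) + 2 * pi"
    by (auto simp: field_simps)
  then show "t + of_int (-n) * (2 * pi) \<in> {0..2 * pi}" by auto
  show "v (t + of_int (-n) * (2 * pi)) = v t"
    using assms by (intro periodic_shift_int) (auto simp: cont_periodic_def)
qed

text \<open>For a shift within one period, the piece pushed past 2 pi is a copy of the piece lost at
  0. Other shifts are reduced modulo 2 pi.\<close>

lemma integral_cont_periodic_shift:
  assumes v: "cont_periodic v"
  shows "integral {0..2 * pi} (\<lambda>t. v (t + c)) = integral {0..2 * pi} v"
proof -
  note I = cont_periodic_integrable[OF v]
  have nonneg: "integral {0..2 * pi} (\<lambda>t. v (t + c)) = integral {0..2 * pi} v"
    if c: "c \<in> {0..2 * pi}" for c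
  proof -
    have "integral {0..2 * pi} (\<lambda>t. v (t + c)) = integral {c..2 * pi + c} v"
      using integral_shift_real_ivl[of c c "2 * pi + c" v] I by (simp add: add.commute)
    also have "\<dots> = integral {c..2 * pi} v + integral {2 * pi..2 * pi + c} v"
      by (rule Henstock_Kurzweil_Integration.integral_combine[symmetric]) (use c I in auto)
    also have "integral {2 * pi..2 * pi + c} v = integral {0..c} (\<lambda>t. v (t + 2 * pi))"
      using integral_shift_real_ivl[of "2 * pi" "2 * pi" "2 * pi + c" v] I by (simp add: add.commute)
    also have "\<dots> = integral {0..c} v"
      using v by (simp add: cont_periodic_def)
    also have "integral {c..2 * pi} v + integral {0..c} v = integral {0..2 * pi} v"
      using Henstock_Kurzweil_Integration.integral_combine[of 0 c "2 * pi" v] c I by auto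
    finally show ?thesis .
  qed
  define n where "n = \<lfloor>c / (2 * pi)\<rfloor>"
  have "of_int n \<le> c / (2 * pi)" "c / (2 * pi) < of_int n + 1"
    unfolding n_def by linarith+
  then have "of_int n * (2 * pi) \<le> c" "c < of_int n * (2 * pi) + 2 * pi"
    by (auto simp: field_simps)
  then have "c + of_int (-n) * (2 * pi) \<in> {0..2 * pi}" by auto
  from nonneg[OF this]
  have "integral {0..2 * pi} (\<lambda>t. v (t + (c + of_int (-n) * (2 * pi)))) = integral {0..2 * pi} v" .
  moreover have "v (t + (c + of_int (-n) * (2 * pi))) = v (t + c)" for t
    using periodic_shift_int[of v "2 * pi" "t + c" "-n"] v by (simp add: cont_periodic_def add_diff_eq)
  ultimately show ?thesis by (simp only:)
qed

lemma cont_periodic_mode: assumes "cont_periodic v" shows "cont_periodic (\<lambda>t. v t * cos (t - a))"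
  using assms by (intro cont_periodic_intros)

section \<open>Calculus of the first mode: linearity, shifts, derivatives, bounds\<close>

lemma first_mode_add:
  assumes "cont_periodic v" "cont_periodic w"
  shows "first_mode a (\<lambda>t. v t + w t) = first_mode a v + first_mode a w"
    and "first_mode a (\<lambda>t. v t - w t) = first_mode a v - first_mode a w"
  using assms[THEN cont_periodic_mode, THEN cont_periodic_integrable, of a 0 "2 * pi"]
  unfolding first_mode_def
  by (auto simp: algebra_simps Henstock_Kurzweil_Integration.integral_add
      Henstock_Kurzweil_Integration.integral_diff add_divide_distrib diff_divide_distrib)

lemma first_mode_cmult: "first_mode a (\<lambda>t. c * v t) = c * first_mode a v"
  unfolding first_mode_def by (simp add: mult.assoc)

lemma first_mode_shift:
  assumes "cont_periodic v"
  shows "first_mode a (\<lambda>t. v (t - c)) = first_mode (a - c) v"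
proof -
  have "integral {0..2 * pi} (\<lambda>t. v (t + (-c)) * cos (t + (-c) - (a - c)))
      = integral {0..2 * pi} (\<lambda>t. v t * cos (t - (a - c)))"
    using integral_cont_periodic_shift[OF cont_periodic_mode[OF assms, of "a - c"], of "-c"] by simp
  then show ?thesis unfolding first_mode_def by simp
qed

text \<open>Addition formula for cos. The phases 0 and pi/2 therefore determine the whole first
  mode.\<close>

lemma first_mode_phase:
  assumes "cont_periodic v"
  shows "first_mode a v = cos a * first_mode 0 v + sin a * first_mode (pi / 2) v"
proof -
  have 1: "first_mode 0 v = integral {0..2 * pi} (\<lambda>t. v t * cos t) / pi"
    and 2: "first_mode (pi / 2) v = integral {0..2 * pi} (\<lambda>t. v t * sin t) / pi"
    unfolding first_mode_def by (auto simp: cos_diff)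
  have "(\<lambda>t. v t * cos t) integrable_on {0..2 * pi}"
    by (rule cont_periodic_integrable[OF cont_periodic_arith(3)[OF assms cont_periodic_simple(3)]])
  moreover have "(\<lambda>t. v t * sin t) integrable_on {0..2 * pi}"
    by (rule cont_periodic_integrable[OF cont_periodic_arith(3)[OF assms cont_periodic_simple(2)]])
  ultimately have "((\<lambda>t. cos a * (v t * cos t) + sin a * (v t * sin t)) has_integral
     cos a * integral {0..2 * pi} (\<lambda>t. v t * cos t) + sin a * integral {0..2 * pi} (\<lambda>t. v t * sin t))
       {0..2 * pi}"
    by (intro has_integral_add has_integral_mult_right integrable_integral)
  from integral_unique[OF this]
  have "integral {0..2 * pi} (\<lambda>t. cos a * (v t * cos t) + sin a * (v t * sin t))
     = cos a * integral {0..2 * pi} (\<lambda>t. v t * cos t) + sin a * integral {0..2 * pi} (\<lambda>t. v t * sin t)" .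
  then show ?thesis
    unfolding 1 2 first_mode_def by (simp add: cos_diff algebra_simps add_divide_distrib)
qed

text \<open>Integration by parts: the boundary terms cancel by periodicity, and the sine produced is
  a cosine with phase advanced by pi/2.\<close>

lemma first_mode_deriv:
  assumes v: "cont_periodic v" and v': "cont_periodic v'"
    and d: "\<And>t. (v has_real_derivative v' t) (at t)"
  shows "first_mode a v' = first_mode (a + pi / 2) v"
proof -
  have "((\<lambda>t. v' t * cos (t - a) - v t * sin (t - a)) has_integral
      v (2 * pi) * cos (2 * pi - a) - v 0 * cos (0 - a)) {0..2 * pi}"
  proof (rule fundamental_theorem_of_calculus)
    fix t
    have "((\<lambda>t. v t * cos (t - a)) has_real_derivative
        v' t * cos (t - a) - v t * sin (t - a)) (at t)"
      by (auto intro!: derivative_eq_intros d)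
    then show "((\<lambda>t. v t * cos (t - a)) has_vector_derivative
        v' t * cos (t - a) - v t * sin (t - a)) (at t within {0..2 * pi})"
      by (simp add: has_real_derivative_iff_has_vector_derivative has_vector_derivative_at_within)
  qed simp
  moreover have "v (2 * pi) = v 0" using v unfolding cont_periodic_def by (metis add_0)
  ultimately have "integral {0..2 * pi} (\<lambda>t. v' t * cos (t - a) - v t * sin (t - a)) = 0"
    by (auto simp: cos_diff)
  moreover have "(\<lambda>t. v' t * cos (t - a)) integrable_on {0..2 * pi}"
    by (rule cont_periodic_integrable[OF cont_periodic_mode[OF v']])
  moreover have "(\<lambda>t. v t * sin (t - a)) integrable_on {0..2 * pi}"
    by (intro cont_periodic_integrable cont_periodic_arith(3)[OF v]
        cont_periodic_shift'[OF cont_periodic_simple(2)])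
  ultimately have "integral {0..2 * pi} (\<lambda>t. v' t * cos (t - a))
      = integral {0..2 * pi} (\<lambda>t. v t * sin (t - a))"
    by (simp add: Henstock_Kurzweil_Integration.integral_diff)
  moreover have "cos (t - (a + pi / 2)) = sin (t - a)" for t
    using sin_cos_eq[of "t - a"] cos_minus[of "pi / 2 - (t - a)"] by (simp add: algebra_simps)
  ultimately show ?thesis unfolding first_mode_def by simp
qed

text \<open>The factor 2 is the interval length 2 pi divided by the normalization pi.\<close>

lemma first_mode_bound:
  assumes "cont_periodic v" "\<And>t. \<bar>v t\<bar> \<le> N"
  shows "\<bar>first_mode a v\<bar> \<le> 2 * N"
proof -
  have "\<bar>v t * cos (t - a)\<bar> \<le> N" for t
    using mult_mono[OF assms(2)[of t] abs_cos_le_one[of "t - a"]] assms(2)[of t]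
    by (simp add: abs_mult)
  then have "norm (integral {0..2 * pi} (\<lambda>t. v t * cos (t - a))) \<le> integral {0..2 * pi} (\<lambda>t. N)"
    using assms(1)
    by (intro integral_norm_bound_integral cont_periodic_integrable cont_periodic_mode cont_periodic_simple) auto
  then show ?thesis unfolding first_mode_def by (simp add: field_simps abs_divide)
qed

text \<open>Write the two coefficients in polar form with angle \<open>a\<close>. The mode vanishes
  at the phase perpendicular to \<open>a\<close>, and a translation moves this phase to
  pi/2.\<close>

lemma first_mode_zero_translate:
  assumes "cont_periodic v"
  obtains c where "first_mode (pi / 2) (\<lambda>t. v (t - c)) = 0"
proof -
  obtain r a where ra: "first_mode 0 v = r * cos a" "first_mode (pi / 2) v = r * sin a"
    using polar_Ex by blast
  have "first_mode (a + pi / 2) v = 0"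
    using first_mode_phase[OF assms, of "a + pi / 2"] ra by (simp add: cos_add sin_add)
  then have "first_mode (pi / 2) (\<lambda>t. v (t - (-a))) = 0"
    by (subst first_mode_shift[OF assms]) (simp add: add.commute)
  then show ?thesis using that by blast
qed

text \<open>Evaluates the modes of explicit functions: a guessed antiderivative \<open>V\<close> is
  checked by differentiation, and only its increment over a period counts.\<close>

lemma first_mode_trig:
  assumes "\<And>t. (V has_real_derivative v t * cos (t - a)) (at t)" "V (2 * pi) - V 0 = pi * I"
  shows "first_mode a v = I"
proof -
  have "((\<lambda>t. v t * cos (t - a)) has_integral V (2 * pi) - V 0) {0..2 * pi}"
    using assms(1) by (intro fundamental_theorem_of_calculus)
      (simp_all add: has_real_derivative_iff_has_vector_derivative has_vector_derivative_at_within)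
  then show ?thesis unfolding first_mode_def using assms(2) by (auto simp: integral_unique)
qed

section \<open>Sup-norm estimate for the linear delay equation\<close>

lemma cont_periodic_abs_max:
  assumes "cont_periodic v" obtains m where "\<And>t. \<bar>v t\<bar> \<le> \<bar>v m\<bar>"
proof -
  have "continuous_on {0..2 * pi} (\<lambda>t. \<bar>v t\<bar>)"
    using assms unfolding cont_periodic_def
    by (auto intro: continuous_on_rabs continuous_on_subset)
  then obtain m where m: "\<And>t. t \<in> {0..2 * pi} \<Longrightarrow> \<bar>v t\<bar> \<le> \<bar>v m\<bar>"
    using continuous_attains_sup[of "{0..2 * pi}" "\<lambda>t. \<bar>v t\<bar>"] pi_ge_zero by fastforce
  have "\<bar>v t\<bar> \<le> \<bar>v m\<bar>" for t
    using cont_periodic_reduce[OF assms, of t] m by metis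
  then show ?thesis using that by blast
qed

text \<open>At a maximum of s^2 the derivative 2 s s' vanishes, so there s = 0 or |s| = |g|. By
  periodicity the maximum exists, and the sign of \<open>c\<close> is irrelevant.\<close>

lemma scalar_periodic_bound:
  fixes c :: real
  assumes s: "cont_periodic s" and d: "\<And>t. (s has_real_derivative c * s t + g t) (at t)"
    and c: "\<bar>c\<bar> = 1" and g: "\<And>t. \<bar>g t\<bar> \<le> N"
  shows "\<bar>s t\<bar> \<le> N"
proof -
  obtain m where m: "\<And>t. \<bar>s t\<bar> \<le> \<bar>s m\<bar>" using cont_periodic_abs_max[OF s] by blast
  have "((\<lambda>t. s t * s t) has_real_derivative 2 * s m * (c * s m + g m)) (at m)"
    by (auto intro!: derivative_eq_intros d)
  moreover have "s t * s t \<le> s m * s m" for t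
    using mult_mono[OF m[of t] m[of t]] by (simp flip: abs_mult)
  ultimately have "2 * s m * (c * s m + g m) = 0"
    by (intro DERIV_local_max[of "\<lambda>t. s t * s t" _ m 1]) auto
  then have "s m = 0 \<or> g m = - (c * s m)" by (simp add: eq_neg_iff_add_eq_0 add.commute)
  then have "\<bar>s m\<bar> \<le> N" using g[of m] c by (auto simp: abs_mult)
  then show ?thesis using m[of t] by linarith
qed

lemma deriv_bound_lipschitz:
  fixes v :: "real \<Rightarrow> real"
  assumes "\<And>t. (v has_real_derivative v' t) (at t)" "\<And>t. \<bar>v' t\<bar> \<le> N"
  shows "\<bar>v s - v t\<bar> \<le> N * \<bar>s - t\<bar>"
  using field_differentiable_bound[of UNIV v v' N s t] assms by auto

text \<open>Over one period \<open>P\<close> stays within 2 pi N of any of its values. Integrating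
  both one-sided bounds and using mean zero confines that value.\<close>

lemma mean_zero_bound:
  assumes P: "cont_periodic P" and d: "\<And>t. (P has_real_derivative P' t) (at t)"
    and N: "\<And>t. \<bar>P' t\<bar> \<le> N" and mean: "integral {0..2 * pi} P = 0"
  shows "\<bar>P t\<bar> \<le> 2 * pi * N"
proof -
  obtain s where s: "s \<in> {0..2 * pi}" "P s = P t" by (rule cont_periodic_reduce[OF P])
  have N0: "N \<ge> 0" using N[of 0] by linarith
  have close: "\<bar>P r - P s\<bar> \<le> 2 * pi * N" if "r \<in> {0..2 * pi}" for r
  proof -
    have "\<bar>P r - P s\<bar> \<le> N * \<bar>r - s\<bar>" by (rule deriv_bound_lipschitz[OF d N])
    also have "\<dots> \<le> N * (2 * pi)" by (rule mult_left_mono) (use that s N0 in auto)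
    finally show ?thesis by (simp add: mult.commute)
  qed
  have I: "P integrable_on {0..2 * pi}" by (rule cont_periodic_integrable[OF P])
  have "integral {0..2 * pi} (\<lambda>r. P s - 2 * pi * N) \<le> integral {0..2 * pi} P"
  proof (rule integral_le)
    fix r assume "r \<in> {0..2 * pi}"
    from close[OF this] show "P s - 2 * pi * N \<le> P r" by linarith
  qed (use I in auto)
  then have 1: "P s - 2 * pi * N \<le> 0" using mean pi_gt_zero by (auto simp: mult_le_0_iff)
  have "integral {0..2 * pi} P \<le> integral {0..2 * pi} (\<lambda>r. P s + 2 * pi * N)"
  proof (rule integral_le)
    fix r assume "r \<in> {0..2 * pi}"
    from close[OF this] show "P r \<le> P s + 2 * pi * N" by linarith
  qed (use I in auto)
  then have 2: "P s + 2 * pi * N \<ge> 0" using mean pi_gt_zero by (auto simp: zero_le_mult_iff)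
  show ?thesis using 1 2 s(2) by linarith
qed

text \<open>Four quarter delays make a full period, so the translates of \<open>y\<close> solve a
  cyclic linear ODE system. Its sum and alternating sum obey scalar equations with rates -1 and 1.
  The remaining plane carries a rotation, which is resonant; there the vanishing first mode replaces
  invertibility.\<close>

lemma quarter_delay_bound:
  assumes y: "cont_periodic y" and h: "\<And>t. \<bar>h t\<bar> \<le> N"
    and d: "\<And>t. (y has_real_derivative - y (t - pi / 2) + h t) (at t)"
    and mode: "\<And>a. first_mode a y = 0"
  shows "\<bar>y t\<bar> \<le> 18 * N"
proof -
  define y1 where "y1 = (\<lambda>t. y (t - pi / 2))"
  define y2 where "y2 = (\<lambda>t. y (t - pi))"
  define y3 where "y3 = (\<lambda>t. y (t - 3 * pi / 2))"
  define h1 where "h1 = (\<lambda>t. h (t - pi / 2))"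
  define h2 where "h2 = (\<lambda>t. h (t - pi))"
  define h3 where "h3 = (\<lambda>t. h (t - 3 * pi / 2))"
  note defs = y1_def y2_def y3_def h1_def h2_def h3_def
  have per [intro]: "cont_periodic y1" "cont_periodic y2" "cont_periodic y3"
    unfolding defs by (rule cont_periodic_shift'[OF y])+
  have modes [simp]: "first_mode a y1 = 0" "first_mode a y2 = 0" "first_mode a y3 = 0" for a
    unfolding defs by (simp_all add: first_mode_shift y mode)
  have hb: "\<bar>h1 t\<bar> \<le> N" "\<bar>h2 t\<bar> \<le> N" "\<bar>h3 t\<bar> \<le> N" for t
    unfolding defs by (rule h)+
  have N0: "N \<ge> 0" using h[of 0] by linarith
  have shift: "((\<lambda>t. y (t - c)) has_real_derivative - y (t - c - pi / 2) + h (t - c)) (at t)" for c t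
    using d[of "t - c"] DERIV_shift[of y _ t "- c"] by simp
  have y4: "y (t - 2 * pi) = y t" for t
    using y unfolding cont_periodic_def by (metis diff_add_cancel)
  have d0: "(y has_real_derivative - y1 t + h t) (at t)" for t
    using d unfolding defs .
  have d1: "(y1 has_real_derivative - y2 t + h1 t) (at t)" for t
    using shift[of "pi / 2" t] unfolding defs by (simp add: algebra_simps)
  have d2: "(y2 has_real_derivative - y3 t + h2 t) (at t)" for t
    using shift[of "pi" t] unfolding defs by (simp add: algebra_simps)
  have d3: "(y3 has_real_derivative - y t + h3 t) (at t)" for t
    using shift[of "3 * pi / 2" t] y4[of t] unfolding defs by (simp add: algebra_simps)
  note D = d0 d1 d2 d3
  have s: "\<bar>y t + y2 t + (y1 t + y3 t)\<bar> \<le> 4 * N" for t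
  proof (rule scalar_periodic_bound[where s = "\<lambda>t. y t + y2 t + (y1 t + y3 t)" and c = "-1" and g = "\<lambda>t. h t + h1 t + h2 t + h3 t"])
    show "cont_periodic (\<lambda>t. y t + y2 t + (y1 t + y3 t))"
      by (intro cont_periodic_arith y per)
    fix t
    show "\<bar>h t + h1 t + h2 t + h3 t\<bar> \<le> 4 * N" using hb[of t] h[of t] by linarith
    show "((\<lambda>t. y t + y2 t + (y1 t + y3 t)) has_real_derivative
        (- 1) * (y t + y2 t + (y1 t + y3 t)) + (h t + h1 t + h2 t + h3 t)) (at t)"
      by (rule derivative_eq_intros D refl)+ simp
  qed simp
  have a: "\<bar>y t + y2 t - (y1 t + y3 t)\<bar> \<le> 4 * N" for t
  proof (rule scalar_periodic_bound[where s = "\<lambda>t. y t + y2 t - (y1 t + y3 t)" and c = "1" and g = "\<lambda>t. h t - h1 t + h2 t - h3 t"])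
    show "cont_periodic (\<lambda>t. y t + y2 t - (y1 t + y3 t))"
      by (intro cont_periodic_arith y per)
    fix t
    show "\<bar>h t - h1 t + h2 t - h3 t\<bar> \<le> 4 * N" using hb[of t] h[of t] by linarith
    show "((\<lambda>t. y t + y2 t - (y1 t + y3 t)) has_real_derivative
        1 * (y t + y2 t - (y1 t + y3 t)) + (h t - h1 t + h2 t - h3 t)) (at t)"
      by (rule derivative_eq_intros D refl)+ simp
  qed simp
  \<comment> \<open>The resonant pair: without forcing, w' = -v and v' = w.\<close>
  define w where "w = (\<lambda>t. y t - y2 t)"
  define v where "v = (\<lambda>t. y1 t - y3 t)"
  have wper: "cont_periodic w" and vper: "cont_periodic v"
    unfolding w_def v_def by (intro cont_periodic_arith y per)+
  have wmode: "first_mode c w = 0" and vmode: "first_mode c v = 0" for c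
    unfolding w_def v_def by (simp_all add: first_mode_add per y mode)
  have dw: "(w has_real_derivative - v t + (h t - h2 t)) (at t)"
    and dv: "(v has_real_derivative w t + (h1 t - h3 t)) (at t)" for t
    unfolding w_def v_def by ((rule derivative_eq_intros D refl)+, simp)+
  have w: "\<bar>w t\<bar> \<le> 2 * pi * (4 * N)" for t
  proof -
    \<comment> \<open>In the frame rotating with \<open>(w, v)\<close>, which has mean zero, only the forcing is left.\<close>
    define P where "P = (\<lambda>r. w r * cos (r - t) + v r * cos (r - (t + pi / 2)))"
    have sin: "cos (r - (t + pi / 2)) = sin (r - t)" for r
      using cos_diff[of "r - t" "pi / 2"] by (simp add: algebra_simps)
    have "\<bar>P t\<bar> \<le> 2 * pi * (4 * N)"
    proof (rule mean_zero_bound[where P = P])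
      show "cont_periodic P"
        unfolding P_def by (intro cont_periodic_arith cont_periodic_mode wper vper)
      fix r
      let ?P' = "(h r - h2 r) * cos (r - t) + (h1 r - h3 r) * sin (r - t)"
      show "(P has_real_derivative ?P') (at r)"
        unfolding P_def sin by (rule derivative_eq_intros dw dv refl)+ (simp add: algebra_simps)
      have "\<bar>(h r - h2 r) * cos (r - t)\<bar> \<le> (2 * N) * 1"
        unfolding abs_mult by (rule mult_mono) (use h[of r] hb[of r] in auto)
      moreover have "\<bar>(h1 r - h3 r) * sin (r - t)\<bar> \<le> (2 * N) * 1"
        unfolding abs_mult by (rule mult_mono) (use h[of r] hb[of r] in auto)
      ultimately show "\<bar>?P'\<bar> \<le> 4 * N" by linarith
      have "integral {0..2 * pi} P = pi * first_mode t w + pi * first_mode (t + pi / 2) v"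
        unfolding P_def first_mode_def
        by (subst Henstock_Kurzweil_Integration.integral_add)
           (auto intro!: cont_periodic_integrable cont_periodic_mode wper vper)
      then show "integral {0..2 * pi} P = 0" by (simp add: wmode vmode)
    qed
    then show ?thesis unfolding P_def by simp
  qed
  \<comment> \<open>With pi < 4 the three parts of \<open>4 * y t\<close> are at most 4N, 4N and
    64N, which gives the constant 18.\<close>
  have "4 * pi * N \<le> 16 * N"
    using mult_right_mono[of "pi" 4 N] pi_less_4 N0 by linarith
  moreover have "4 * y t = (y t + y2 t + (y1 t + y3 t)) + (y t + y2 t - (y1 t + y3 t)) + 2 * w t"
    unfolding w_def by simp
  moreover have "\<bar>w t\<bar> \<le> 2 * (4 * pi * N)" using w[of t] by simp
  ultimately show ?thesis using s[of t] a[of t] by linarith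
qed

text \<open>Perturbation of the exact quarter delay. The errors in \<open>l\<close> and
  \<open>s\<close> become forcing proportional to sup |y|, small enough to be absorbed.\<close>

lemma near_quarter_delay_bound:
  assumes y: "cont_periodic y" and h: "\<And>t. \<bar>h t\<bar> \<le> N"
    and d: "\<And>t. (y has_real_derivative - l * y (t - s) + h t) (at t)"
    and mode: "\<And>a. first_mode a y = 0"
    and l: "\<bar>l - 1\<bar> \<le> 1 / 180" and s: "\<bar>s - pi / 2\<bar> \<le> 1 / 180"
  shows "\<bar>y t\<bar> \<le> 72 * N"
proof -
  obtain m where m: "\<And>t. \<bar>y t\<bar> \<le> \<bar>y m\<bar>" using cont_periodic_abs_max[OF y] by blast
  define Y where "Y = \<bar>y m\<bar>"
  have Y0: "Y \<ge> 0" unfolding Y_def by simp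
  have N0: "N \<ge> 0" using h[of 0] by linarith
  have mY: "\<bar>y t\<bar> \<le> Y" for t using m unfolding Y_def .
  have l2: "\<bar>l\<bar> \<le> 2" using l by linarith
  have ly: "\<bar>l * y t\<bar> \<le> 2 * Y" for t
    unfolding abs_mult by (rule mult_mono) (use l2 mY Y0 in auto)
  define g where "g = (\<lambda>t. y (t - pi / 2) - l * y (t - s) + h t)"
  have gb: "\<bar>g t\<bar> \<le> 2 * N + 3 / 180 * Y" for t
  proof -
    \<comment> \<open>The equation itself bounds y' by 2Y + N, which controls the effect of changing
      the delay.\<close>
    have "\<bar>y (t - pi / 2) - y (t - s)\<bar> \<le> (2 * Y + N) * \<bar>(t - pi / 2) - (t - s)\<bar>"
    proof (rule deriv_bound_lipschitz[OF d])
      fix t show "\<bar>- l * y (t - s) + h t\<bar> \<le> 2 * Y + N"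
        using ly[of "t - s"] h[of t] by linarith
    qed
    also have "\<dots> \<le> (2 * Y + N) * (1 / 180)"
      by (rule mult_left_mono) (use s Y0 N0 in auto)
    finally have 1: "\<bar>y (t - pi / 2) - y (t - s)\<bar> \<le> (2 * Y + N) * (1 / 180)" .
    have 2: "\<bar>(1 - l) * y (t - s)\<bar> \<le> 1 / 180 * Y"
      unfolding abs_mult by (rule mult_mono) (use l mY Y0 in \<open>auto simp: abs_minus_commute\<close>)
    have "\<bar>g t\<bar> \<le> \<bar>y (t - pi / 2) - y (t - s)\<bar> + \<bar>(1 - l) * y (t - s)\<bar> + \<bar>h t\<bar>"
      unfolding g_def by (simp add: algebra_simps)
    also have "\<dots> \<le> (2 * Y + N) * (1 / 180) + 1 / 180 * Y + N"
      by (intro add_mono 1 2 h)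
    finally show ?thesis using N0 by (simp add: field_simps)
  qed
  have d': "(y has_real_derivative - y (t - pi / 2) + g t) (at t)" for t
    using d[of t] by (simp add: g_def)
  \<comment> \<open>Here 18 * 3/180 = 3/10 < 1/2, so the \<open>Y\<close> term moves to the left at
    the cost of at most doubling 36 N.\<close>
  have "\<bar>y m\<bar> \<le> 18 * (2 * N + 3 / 180 * Y)"
    by (rule quarter_delay_bound[OF y gb d' mode])
  then show ?thesis using mY[of t] N0 unfolding Y_def by simp
qed

section \<open>The second-order profile\<close>

lemma first_mode_cos: "first_mode a cos = cos a"
proof -
  have "first_mode 0 cos = 1"
    by (rule first_mode_trig[where V = "\<lambda>t. t / 2 + sin t * cos t / 2"])
       (auto intro!: derivative_eq_intros simp: cos_squared_eq power2_eq_square field_simps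
         simp flip: power2_eq_square)
  moreover have "first_mode (pi / 2) cos = 0"
    by (rule first_mode_trig[where V = "\<lambda>t. sin t * sin t / 2"])
       (auto intro!: derivative_eq_intros simp: cos_diff)
  ultimately show ?thesis by (simp add: first_mode_phase[OF cont_periodic_simple(3), of a])
qed

text \<open>Only the harmonics 0 and 2 occur in cos^2. Hence \<open>B\<close> affects the first mode
  no earlier than at third order in the amplitude.\<close>

lemma first_mode_cos_squared: "first_mode a (\<lambda>t. cos t * cos t) = 0"
proof -
  have "first_mode 0 (\<lambda>t. cos t * cos t) = 0"
    by (rule first_mode_trig[where V = "\<lambda>t. sin t - sin t ^ 3 / 3"])
       (auto intro!: derivative_eq_intros simp: cos_squared_eq power2_eq_square field_simps
         simp flip: power2_eq_square)
  moreover have "first_mode (pi / 2) (\<lambda>t. cos t * cos t) = 0"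
    by (rule first_mode_trig[where V = "\<lambda>t. - (cos t ^ 3) / 3"])
       (auto intro!: derivative_eq_intros simp: cos_diff power2_eq_square)
  ultimately show ?thesis
    by (subst first_mode_phase) (auto intro: cont_periodic_intros)
qed

text \<open>The periodic solution without first mode of the second-order equation
  \<open>q'(t) = -(q + cos\<^sup>2)(t - \<pi>/2)\<close> at criticality.\<close>

definition profile :: "real \<Rightarrow> real" where
  "profile t = - 1 / 2 - cos (2 * t) / 10 + sin (2 * t) / 5"

definition profile_force :: "real \<Rightarrow> real" where
  "profile_force t = cos t * cos t + profile t"

text \<open>The constant -1/2 in \<open>profile\<close> cancels the mean of cos^2, leaving a pure
  second harmonic.\<close>

lemma profile_force_eq: "profile_force t = 2 / 5 * cos (2 * t) + sin (2 * t) / 5"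
  unfolding profile_force_def profile_def cos_double_cos by (simp add: power2_eq_square field_simps)

text \<open>A quarter-period delay shifts the second harmonic by pi, that is, flips its
  sign.\<close>

lemma profile_deriv: "(profile has_real_derivative - profile_force (t - pi / 2)) (at t)"
proof -
  have "2 * (t - pi / 2) = 2 * t - pi" by simp
  then show ?thesis
    unfolding profile_force_eq profile_def
    by (auto intro!: derivative_eq_intros simp: cos_diff sin_diff)
qed

lemma profile_bound: "\<bar>profile t\<bar> \<le> 1"
  unfolding profile_def using abs_cos_le_one[of "2 * t"] abs_sin_le_one[of "2 * t"] by linarith

lemma profile_force_bound: "\<bar>profile_force t\<bar> \<le> 1"
  unfolding profile_force_eq using abs_cos_le_one[of "2 * t"] abs_sin_le_one[of "2 * t"] by linarith

lemma profile_force_lipschitz: "\<bar>profile_force s - profile_force t\<bar> \<le> 2 * \<bar>s - t\<bar>"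
proof (rule deriv_bound_lipschitz)
  fix t
  show "(profile_force has_real_derivative - 4 / 5 * sin (2 * t) + 2 / 5 * cos (2 * t)) (at t)"
    unfolding profile_force_eq[abs_def] by (auto intro!: derivative_eq_intros)
  show "\<bar>- 4 / 5 * sin (2 * t) + 2 / 5 * cos (2 * t)\<bar> \<le> 2"
    using abs_cos_le_one[of "2 * t"] abs_sin_le_one[of "2 * t"] by linarith
qed

lemma profile_periodic: "cont_periodic profile"
proof -
  have "cont_periodic (\<lambda>t. - 1 / 2 + (- 1 / 10) * cos (2 * t) + 1 / 5 * sin (2 * t))"
    by (intro cont_periodic_arith cont_periodic_simple)
  then show ?thesis unfolding profile_def[abs_def] by simp
qed

text \<open>The harmonics 0 and 2 are orthogonal to the first one. The double-angle formulas give
  antiderivatives polynomial in sin and cos.\<close>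

lemma first_mode_profile: "first_mode a profile = 0"
proof -
  have "first_mode 0 profile = 0"
  proof (rule first_mode_trig)
    fix t :: real
    have "profile t * cos (t - 0) = - 1 / 2 * cos t - (cos t - 2 * (sin t)\<^sup>2 * cos t) / 10
        + 2 / 5 * (cos t)\<^sup>2 * sin t"
      unfolding profile_def cos_double_sin sin_double by (simp add: power2_eq_square field_simps)
    moreover have "((\<lambda>t. - 1 / 2 * sin t - (sin t - 2 / 3 * sin t ^ 3) / 10 - 2 / 15 * cos t ^ 3)
        has_real_derivative - 1 / 2 * cos t - (cos t - 2 * (sin t)\<^sup>2 * cos t) / 10
        + 2 / 5 * (cos t)\<^sup>2 * sin t) (at t)"
      by (auto intro!: derivative_eq_intros simp: field_simps)
    ultimately show "((\<lambda>t. - 1 / 2 * sin t - (sin t - 2 / 3 * sin t ^ 3) / 10 - 2 / 15 * cos t ^ 3)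
        has_real_derivative profile t * cos (t - 0)) (at t)" by simp
  qed simp
  moreover have "first_mode (pi / 2) profile = 0"
  proof (rule first_mode_trig)
    fix t :: real
    have "profile t * cos (t - pi / 2) = - 1 / 2 * sin t - (2 * (cos t)\<^sup>2 * sin t - sin t) / 10
        + 2 / 5 * (sin t)\<^sup>2 * cos t"
      unfolding profile_def cos_double_cos sin_double cos_diff
      by (simp add: power2_eq_square field_simps)
    moreover have "((\<lambda>t. 1 / 2 * cos t - (cos t - 2 / 3 * cos t ^ 3) / 10 + 2 / 15 * sin t ^ 3)
        has_real_derivative - 1 / 2 * sin t - (2 * (cos t)\<^sup>2 * sin t - sin t) / 10
        + 2 / 5 * (sin t)\<^sup>2 * cos t) (at t)"
      by (auto intro!: derivative_eq_intros simp: field_simps)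
    ultimately show "((\<lambda>t. 1 / 2 * cos t - (cos t - 2 / 3 * cos t ^ 3) / 10 + 2 / 15 * sin t ^ 3)
        has_real_derivative profile t * cos (t - pi / 2)) (at t)" by simp
  qed simp
  ultimately show ?thesis by (simp add: first_mode_phase[OF profile_periodic, of a])
qed

lemma cos_sq_double: "cos t * cos t = (1 + cos (2 * t)) / 2" for t :: real
  unfolding cos_double_cos by (simp add: power2_eq_square)

lemma first_mode_profile_cos: "first_mode 0 (\<lambda>t. profile t * cos t) = - 11 / 20"
proof (rule first_mode_trig)
  fix t :: real
  \<comment> \<open>Only the linear term has an increment over a period. Its slope is the mean of
    profile * cos^2: -1/4 from the constant and -1/40 from the cos(2t) part.\<close>
  let ?V = "\<lambda>t. - 11 / 40 * t - 3 / 20 * sin (2 * t) - 1 / 80 * (sin (2 * t) * cos (2 * t))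
      - 1 / 20 * cos (2 * t) + 1 / 40 * (sin (2 * t) * sin (2 * t))"
  have "profile t * cos t * cos (t - 0) = profile t * ((1 + cos (2 * t)) / 2)"
    by (simp flip: cos_sq_double)
  also have "\<dots> = - 1 / 4 - 3 / 10 * cos (2 * t) - (cos (2 * t))\<^sup>2 / 20
      + sin (2 * t) / 10 + sin (2 * t) * cos (2 * t) / 10"
    unfolding profile_def by (simp add: power2_eq_square field_simps)
  finally have eq: "profile t * cos t * cos (t - 0) = - 1 / 4 - 3 / 10 * cos (2 * t)
      - (cos (2 * t))\<^sup>2 / 20 + sin (2 * t) / 10 + sin (2 * t) * cos (2 * t) / 10" .
  have "(?V has_real_derivative - 11 / 40 - 3 / 10 * cos (2 * t)
      - 1 / 40 * ((cos (2 * t))\<^sup>2 - (sin (2 * t))\<^sup>2) + 1 / 10 * sin (2 * t)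
      + 1 / 10 * (sin (2 * t) * cos (2 * t))) (at t)"
    by (rule derivative_eq_intros refl)+ (simp add: power2_eq_square algebra_simps)
  then show "(?V has_real_derivative profile t * cos t * cos (t - 0)) (at t)"
    unfolding eq by (rule DERIV_cong) (simp add: sin_squared_eq field_simps)
qed simp

lemma first_mode_cos_cubed: "first_mode 0 (\<lambda>t. cos t * cos t * cos t) = 3 / 4"
proof (rule first_mode_trig)
  fix t :: real
  \<comment> \<open>The slope 3/8 is the mean of cos^4.\<close>
  let ?V = "\<lambda>t. 3 / 8 * t + 1 / 4 * sin (2 * t) + 1 / 16 * (sin (2 * t) * cos (2 * t))"
  have "cos t * cos t * cos t * cos (t - 0) = ((1 + cos (2 * t)) / 2) * ((1 + cos (2 * t)) / 2)"
    by (simp flip: cos_sq_double)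
  also have "\<dots> = 1 / 4 + cos (2 * t) / 2 + (cos (2 * t))\<^sup>2 / 4"
    by (simp add: power2_eq_square field_simps)
  finally have eq: "cos t * cos t * cos t * cos (t - 0) = 1 / 4 + cos (2 * t) / 2 + (cos (2 * t))\<^sup>2 / 4" .
  have "(?V has_real_derivative 3 / 8 + 1 / 2 * cos (2 * t)
      + 1 / 8 * ((cos (2 * t))\<^sup>2 - (sin (2 * t))\<^sup>2)) (at t)"
    by (rule derivative_eq_intros refl)+ (simp add: power2_eq_square algebra_simps)
  then show "(?V has_real_derivative cos t * cos t * cos t * cos (t - 0)) (at t)"
    unfolding eq by (rule DERIV_cong) (simp add: sin_squared_eq field_simps)
qed simp

section \<open>Small orbits with delay near a quarter period\<close>

text \<open>Error constants of the successive approximations, depending only on \<open>L\<close>: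
  \<open>K1\<close> for \<open>y\<close>, \<open>K2\<close> for \<open>g3\<close>, \<open>K3\<close>
  for \<open>Y\<close>, \<open>K4\<close> for \<open>g\<close> minus \<open>cubic\<close>. Their
  independence of the orbit allows the tolerances to be fixed first.\<close>

definition K1 :: "real \<Rightarrow> real" where "K1 L = 1728 * L"
definition K2 :: "real \<Rightarrow> real" where "K2 L = 8 * L + 3 * L * K1 L"
definition K3 :: "real \<Rightarrow> real" where "K3 L = 72 * (12 * K2 L + 3 * L)"
definition K4 :: "real \<Rightarrow> real" where
  "K4 L = 8 + L * (2 * L\<^sup>2 + 4 * K3 L) + 14 * L * K1 L"

text \<open>The bound 1/180 serves the linear estimate, \<open>864 * L * \<epsilon> \<le> 1\<close>
  absorbs the nonlinearity, and \<open>\<epsilon> \<le> \<delta>\<close> lets one tolerance control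
  the final error. The condition at phase pi/2 removes the sine part of the first mode.\<close>

locale small_orbit =
  fixes f u :: "real \<Rightarrow> real" and l s B C \<delta> \<epsilon> A L :: real
  defines "A \<equiv> first_mode 0 u" and "L \<equiv> 1 + \<bar>B\<bar> + \<bar>C\<bar>"
  assumes u: "cont_periodic u"
    and ode: "\<And>t. (u has_real_derivative - l * f (u (t - s))) (at t)"
    and phase: "first_mode (pi / 2) u = 0"
    and l: "\<bar>l - 1\<bar> \<le> \<epsilon>" and s: "\<bar>s - pi / 2\<bar> \<le> \<epsilon>" and small: "\<And>t. \<bar>u t\<bar> \<le> \<epsilon>"
    and taylor: "\<And>x. \<bar>x\<bar> \<le> \<epsilon> \<Longrightarrow> \<bar>f x - x - B * x\<^sup>2 - C * x ^ 3\<bar> \<le> \<delta> * \<bar>x\<bar> ^ 3"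
    and cont: "continuous_on UNIV f"
    and eps: "\<epsilon> \<le> 1 / 180" "864 * L * \<epsilon> \<le> 1" "\<epsilon> \<le> \<delta>" "\<delta> \<le> 1"
    and nonzero: "\<exists>t. u t \<noteq> 0"
begin

definition g :: "real \<Rightarrow> real" where "g t = f (u t) - u t"
definition y :: "real \<Rightarrow> real" where "y t = u t - A * cos t"
definition Y :: "real \<Rightarrow> real" where "Y t = y t - A\<^sup>2 * B * profile t"

section \<open>Basic bounds and the balance of first modes\<close>

lemma eps0: "\<epsilon> \<ge> 0" using l by linarith
lemma delta0: "\<delta> \<ge> 0" using eps eps0 by linarith
lemma L1: "L \<ge> 1" "\<bar>B\<bar> \<le> L" "\<bar>C\<bar> \<le> L" unfolding L_def by auto
lemma l2: "\<bar>l\<bar> \<le> 2" using l eps by linarith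

lemma K_nonneg: "K1 L \<ge> 0" "K2 L \<ge> 0" "K3 L \<ge> 0" "K4 L \<ge> 0"
  using L1 by (auto simp: K1_def K2_def K3_def K4_def)

lemma fu_periodic: "cont_periodic (\<lambda>t. f (u t))"
  by (rule cont_periodic_compose[OF u cont])

lemma g_periodic: "cont_periodic g"
  unfolding g_def[abs_def] by (intro cont_periodic_arith fu_periodic u)

lemma first_mode_u: "first_mode a u = A * cos a"
  using first_mode_phase[OF u, of a] phase by (simp add: A_def)

lemma first_mode_fu: "first_mode a (\<lambda>t. f (u t)) = A * cos a + first_mode a g"
proof -
  have "(\<lambda>t. f (u t)) = (\<lambda>t. u t + g t)" by (simp add: g_def)
  then show ?thesis by (simp add: first_mode_add u g_periodic first_mode_u)
qed

text \<open>First mode of both sides of the equation at phase \<open>t\<close>: the derivative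
  advances the phase by pi/2, the delay moves it back by \<open>s\<close>. As an identity in
  \<open>t\<close> it serves both as a function equation and as two scalar equations.\<close>

lemma mode_balance: "A * sin t = l * (A * cos (t - s) + first_mode (t - s) g)"
proof -
  have "cont_periodic (\<lambda>t. - l * f (u (t - s)))"
    by (intro cont_periodic_arith cont_periodic_simple
        cont_periodic_shift'[OF fu_periodic])
  then have "first_mode t (\<lambda>t. - l * f (u (t - s))) = first_mode (t + pi / 2) u"
    by (intro first_mode_deriv u ode)
  moreover have "first_mode t (\<lambda>t. - l * f (u (t - s))) = - l * first_mode (t - s) (\<lambda>t. f (u t))"
    by (simp only: first_mode_cmult first_mode_shift[OF fu_periodic])
  ultimately show ?thesis
    by (simp add: first_mode_u first_mode_fu cos_add algebra_simps)
qed

lemma A_le: "\<bar>A\<bar> \<le> 2 * \<epsilon>"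
  unfolding A_def by (rule first_mode_bound[OF u small])

text \<open>The summand 1 in \<open>L\<close> pays for the Taylor remainder, as
  \<open>\<delta> \<le> 1\<close>; in the first bound |u| \<le> 1 turns cubes into squares.\<close>

lemma g_rough:
  shows "\<bar>g t\<bar> \<le> L * \<bar>u t\<bar>\<^sup>2" and "\<bar>g t - B * (u t)\<^sup>2\<bar> \<le> L * \<bar>u t\<bar> ^ 3"
proof -
  have u1: "\<bar>u t\<bar> \<le> 1" using small[of t] eps by linarith
  have "\<bar>C * (u t) ^ 3\<bar> = \<bar>C\<bar> * \<bar>u t\<bar> ^ 3" by (simp add: abs_mult power_abs)
  moreover have "\<delta> * \<bar>u t\<bar> ^ 3 \<le> 1 * \<bar>u t\<bar> ^ 3" using eps by (intro mult_right_mono) auto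
  ultimately have 1: "\<bar>g t - B * (u t)\<^sup>2\<bar> \<le> (1 + \<bar>C\<bar>) * \<bar>u t\<bar> ^ 3"
    using taylor[OF small[of t]] unfolding g_def distrib_right by linarith
  also have "\<dots> \<le> L * \<bar>u t\<bar> ^ 3" unfolding L_def by (intro mult_right_mono) auto
  finally show "\<bar>g t - B * (u t)\<^sup>2\<bar> \<le> L * \<bar>u t\<bar> ^ 3" .
  have "\<bar>u t\<bar> ^ 3 \<le> \<bar>u t\<bar>\<^sup>2" using u1 by (intro power_decreasing) auto
  then have "(1 + \<bar>C\<bar>) * \<bar>u t\<bar> ^ 3 \<le> (1 + \<bar>C\<bar>) * \<bar>u t\<bar>\<^sup>2" by (intro mult_left_mono) auto
  moreover have "\<bar>B * (u t)\<^sup>2\<bar> = \<bar>B\<bar> * \<bar>u t\<bar>\<^sup>2" by (simp add: abs_mult)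
  ultimately show "\<bar>g t\<bar> \<le> L * \<bar>u t\<bar>\<^sup>2"
    using 1 unfolding L_def distrib_right by linarith
qed

section \<open>First-order estimate: the orbit is close to its first mode\<close>

lemma y_periodic: "cont_periodic y"
  unfolding y_def[abs_def] by (intro cont_periodic_arith cont_periodic_simple u)

lemma first_mode_y: "first_mode a y = 0"
  unfolding y_def[abs_def]
  by (subst first_mode_add)
     (auto intro!: cont_periodic_arith cont_periodic_simple simp: u first_mode_cmult first_mode_u first_mode_cos)

text \<open>Differentiating the subtracted mode produces \<open>A * sin t\<close>, which
  \<open>mode_balance\<close> converts into the projection of \<open>g\<close>. The forcing is thus
  \<open>g\<close> off the first mode, up to sign and the factor \<open>l\<close>.\<close>

lemma y_deriv:
  "(y has_real_derivative - l * y (t - s) + l * (first_mode (t - s) g - g (t - s))) (at t)"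
proof -
  have "(y has_real_derivative - l * f (u (t - s)) + A * sin t) (at t)"
    unfolding y_def[abs_def] by (auto intro!: derivative_eq_intros ode)
  then show ?thesis unfolding mode_balance by (simp add: g_def y_def algebra_simps)
qed

lemma projection_residual_bound:
  assumes "cont_periodic v" "\<And>t. \<bar>v t\<bar> \<le> N"
  shows "\<bar>l * (first_mode a v - v t)\<bar> \<le> 6 * N"
proof -
  have "\<bar>l * (first_mode a v - v t)\<bar> \<le> 2 * (3 * N)"
    unfolding abs_mult
    by (rule mult_mono) (use l2 first_mode_bound[OF assms, of a] assms(2)[of t] in auto)
  then show ?thesis by simp
qed

lemma A_cos: "\<bar>A * cos t\<bar> \<le> \<bar>A\<bar>"
  using mult_left_mono[OF abs_cos_le_one[of t], of "\<bar>A\<bar>"] by (simp add: abs_mult)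

text \<open>Let M be the maximum of |u|. The linear estimate gives |y| \<le> 432 L M^2 \<le> M/2,
  while M \<le> |y| + |A| at the maximum; so M \<le> 2|A|. In particular A = 0 would force u =
  0.\<close>

lemma amplitude: "\<bar>u t\<bar> \<le> 2 * \<bar>A\<bar>" "A \<noteq> 0" "\<bar>y t\<bar> \<le> K1 L * A\<^sup>2"
proof -
  obtain m where m: "\<And>t. \<bar>u t\<bar> \<le> \<bar>u m\<bar>" using cont_periodic_abs_max[OF u] by blast
  define M where "M = \<bar>u m\<bar>"
  have M0: "M \<ge> 0" and Me: "M \<le> \<epsilon>" unfolding M_def using small by auto
  have gM: "\<bar>g t\<bar> \<le> L * M\<^sup>2" for t
  proof -
    have "L * \<bar>u t\<bar>\<^sup>2 \<le> L * M\<^sup>2"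
      unfolding M_def using L1 m[of t] by (intro mult_left_mono power_mono) auto
    then show ?thesis using g_rough(1)[of t] by linarith
  qed
  have yM: "\<bar>y t\<bar> \<le> 72 * (6 * (L * M\<^sup>2))" for t
    by (rule near_quarter_delay_bound[OF y_periodic _ y_deriv first_mode_y])
       (use projection_residual_bound[OF g_periodic gM] l s eps in auto)
  have "864 * L * M \<le> 864 * L * \<epsilon>" using Me L1 by (intro mult_left_mono) auto
  then have "864 * L * M * M \<le> 1 * M" using M0 eps by (intro mult_right_mono) auto
  moreover have "72 * (6 * (L * M\<^sup>2)) * 2 = 864 * L * M * M" by (simp add: power2_eq_square)
  moreover have "M \<le> \<bar>y m\<bar> + \<bar>A * cos m\<bar>" unfolding M_def y_def by linarith
  ultimately have MA: "M \<le> 2 * \<bar>A\<bar>" using yM[of m] A_cos[of m] by linarith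
  then show "\<bar>u t\<bar> \<le> 2 * \<bar>A\<bar>" using m[of t] unfolding M_def by linarith
  show "A \<noteq> 0" using nonzero m MA unfolding M_def by (metis abs_le_zero_iff abs_zero mult_zero_right order.trans)
  have "M\<^sup>2 \<le> (2 * \<bar>A\<bar>)\<^sup>2" using MA M0 by (rule power_mono)
  then have "L * M\<^sup>2 \<le> L * (4 * A\<^sup>2)" using L1 by (intro mult_left_mono) (auto simp: power_mult_distrib)
  then show "\<bar>y t\<bar> \<le> K1 L * A\<^sup>2" using yM[of t] unfolding K1_def by simp
qed

lemma A_cubed: "\<bar>A\<bar> ^ 3 = A\<^sup>2 * \<bar>A\<bar>"
  by (simp add: power3_eq_cube power2_eq_square)

section \<open>Second-order estimate: the profile describes the next term\<close>

definition g3 :: "real \<Rightarrow> real" where "g3 t = g t - B * A\<^sup>2 * (cos t * cos t)"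

text \<open>Factor u^2 - (A cos t)^2 as y (u + A cos t): the first factor is of order A^2, the
  second at most 3|A|.\<close>

lemma g3_bound: "\<bar>g3 t\<bar> \<le> K2 L * \<bar>A\<bar> ^ 3"
proof -
  have "\<bar>u t\<bar> ^ 3 \<le> (2 * \<bar>A\<bar>) ^ 3" using amplitude(1) by (rule power_mono) simp
  then have "L * \<bar>u t\<bar> ^ 3 \<le> L * (8 * \<bar>A\<bar> ^ 3)"
    using L1 by (intro mult_left_mono) (auto simp: power_mult_distrib)
  then have 1: "\<bar>g t - B * (u t)\<^sup>2\<bar> \<le> L * (8 * \<bar>A\<bar> ^ 3)" using g_rough(2)[of t] by linarith
  have "\<bar>B * (y t * (u t + A * cos t))\<bar> \<le> L * (K1 L * A\<^sup>2 * (3 * \<bar>A\<bar>))"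
    unfolding abs_mult
    by (intro mult_mono) (use L1 amplitude(1)[of t] amplitude(3)[of t] A_cos[of t] in \<open>auto simp: K_nonneg\<close>)
  then have 2: "\<bar>B * (y t * (u t + A * cos t))\<bar> \<le> 3 * L * K1 L * \<bar>A\<bar> ^ 3"
    by (simp add: A_cubed mult_ac)
  have "g3 t = (g t - B * (u t)\<^sup>2) + B * (y t * (u t + A * cos t))"
    unfolding g3_def y_def by (simp add: power2_eq_square algebra_simps)
  then have "\<bar>g3 t\<bar> \<le> L * (8 * \<bar>A\<bar> ^ 3) + 3 * L * K1 L * \<bar>A\<bar> ^ 3" using 1 2 by linarith
  then show ?thesis unfolding K2_def by (simp add: algebra_simps)
qed

lemma g3_periodic: "cont_periodic g3"
  unfolding g3_def[abs_def] by (intro cont_periodic_arith cont_periodic_simple g_periodic)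

lemma first_mode_g: "first_mode a g = first_mode a g3"
proof -
  have "cont_periodic (\<lambda>t. B * A\<^sup>2 * (cos t * cos t))" by (intro cont_periodic_arith cont_periodic_simple)
  then show ?thesis unfolding g3_def[abs_def]
    by (simp add: first_mode_add g_periodic first_mode_cmult first_mode_cos_squared del: mult_eq_0_iff)
qed

lemma Y_periodic: "cont_periodic Y"
  unfolding Y_def[abs_def] by (intro cont_periodic_arith cont_periodic_simple y_periodic profile_periodic)

lemma first_mode_Y: "first_mode a Y = 0"
proof -
  have "cont_periodic (\<lambda>t. A\<^sup>2 * B * profile t)"
    by (intro cont_periodic_arith cont_periodic_simple profile_periodic)
  then show ?thesis unfolding Y_def[abs_def]
    by (simp add: first_mode_add y_periodic first_mode_cmult first_mode_profile first_mode_y del: mult_eq_0_iff)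
qed

text \<open>Subtracting the critical profile equation leaves two kinds of forcing: the cubic
  residual \<open>g3\<close>, and the mismatch of \<open>l\<close> and \<open>s\<close> with 1 and
  pi/2. Both are \<epsilon> times A^2.\<close>

lemma Y_bound: "\<bar>Y t\<bar> \<le> K3 L * \<epsilon> * A\<^sup>2"
proof -
  define h where "h t = l * (first_mode (t - s) g3 - g3 (t - s))
      - A\<^sup>2 * (B * (l * profile_force (t - s) - profile_force (t - pi / 2)))" for t
  have d: "(Y has_real_derivative - l * Y (t - s) + h t) (at t)" for t
  proof -
    have "(Y has_real_derivative - l * y (t - s) + l * (first_mode (t - s) g - g (t - s))
        - A\<^sup>2 * B * (- profile_force (t - pi / 2))) (at t)"
      unfolding Y_def[abs_def] by (rule derivative_eq_intros y_deriv profile_deriv refl)+ simp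
    moreover have "- l * y (t - s) + l * (first_mode (t - s) g - g (t - s))
        - A\<^sup>2 * B * (- profile_force (t - pi / 2)) = - l * Y (t - s) + h t"
      unfolding first_mode_g h_def Y_def g3_def profile_force_def[of "t - s"]
      by (simp add: algebra_simps)
    ultimately show ?thesis by simp
  qed
  have hb: "\<bar>h t\<bar> \<le> (12 * K2 L + 3 * L) * \<epsilon> * A\<^sup>2" for t
  proof -
    have "\<bar>l * (first_mode (t - s) g3 - g3 (t - s))\<bar> \<le> 6 * (K2 L * \<bar>A\<bar> ^ 3)"
      by (rule projection_residual_bound[OF g3_periodic g3_bound])
    \<comment> \<open>One factor |A| is traded for 2 \<epsilon>.\<close>
    also have "K2 L * \<bar>A\<bar> ^ 3 \<le> K2 L * (A\<^sup>2 * (2 * \<epsilon>))"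
      unfolding A_cubed using A_le by (intro mult_left_mono K_nonneg) auto
    finally have 1: "\<bar>l * (first_mode (t - s) g3 - g3 (t - s))\<bar> \<le> 6 * (K2 L * (A\<^sup>2 * (2 * \<epsilon>)))"
      by simp
    have "\<bar>(l - 1) * profile_force (t - s)\<bar> \<le> \<epsilon> * 1"
      unfolding abs_mult by (rule mult_mono) (use l profile_force_bound eps0 in auto)
    moreover have "\<bar>profile_force (t - s) - profile_force (t - pi / 2)\<bar> \<le> 2 * \<epsilon>"
      using profile_force_lipschitz[of "t - s" "t - pi / 2"] s by (simp add: abs_minus_commute)
    moreover have "l * profile_force (t - s) - profile_force (t - pi / 2)
        = (l - 1) * profile_force (t - s) + (profile_force (t - s) - profile_force (t - pi / 2))"
      by (simp add: algebra_simps)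
    ultimately have "\<bar>l * profile_force (t - s) - profile_force (t - pi / 2)\<bar> \<le> 3 * \<epsilon>"
      by linarith
    then have "\<bar>A\<^sup>2 * (B * (l * profile_force (t - s) - profile_force (t - pi / 2)))\<bar>
        \<le> A\<^sup>2 * (L * (3 * \<epsilon>))"
      unfolding abs_mult using L1 eps0 by (intro mult_mono) auto
    then have "\<bar>h t\<bar> \<le> 6 * (K2 L * (A\<^sup>2 * (2 * \<epsilon>))) + A\<^sup>2 * (L * (3 * \<epsilon>))"
      using 1 unfolding h_def by linarith
    then show ?thesis by (simp add: algebra_simps)
  qed
  have "\<bar>Y t\<bar> \<le> 72 * ((12 * K2 L + 3 * L) * \<epsilon> * A\<^sup>2)"
    by (rule near_quarter_delay_bound[OF Y_periodic hb d first_mode_Y]) (use l s eps in auto)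
  then show ?thesis unfolding K3_def by (simp add: algebra_simps)
qed

text \<open>Third-order truncation of B u^2 + C u^3 at u = A cos t + A^2 B profile(t).\<close>

definition cubic :: "real \<Rightarrow> real" where
  "cubic t = B * A\<^sup>2 * (cos t * cos t) + (2 * B\<^sup>2 * A ^ 3) * (profile t * cos t)
     + (C * A ^ 3) * (cos t * cos t * cos t)"

lemma g_cubic: "\<bar>g t - cubic t\<bar> \<le> K4 L * \<delta> * \<bar>A\<bar> ^ 3"
proof -
  let ?q = "A\<^sup>2 * B * profile t"
  have A3: "0 \<le> \<bar>A\<bar> ^ 3" by simp
  have "\<bar>u t\<bar> ^ 3 \<le> (2 * \<bar>A\<bar>) ^ 3" using amplitude(1) by (rule power_mono) simp
  then have "\<delta> * \<bar>u t\<bar> ^ 3 \<le> \<delta> * (8 * \<bar>A\<bar> ^ 3)"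
    using delta0 by (intro mult_left_mono) (auto simp: power_mult_distrib)
  then have 1: "\<bar>g t - B * (u t)\<^sup>2 - C * (u t) ^ 3\<bar> \<le> 8 * (\<delta> * \<bar>A\<bar> ^ 3)"
    using taylor[OF small[of t]] unfolding g_def by simp
  have q: "\<bar>?q\<bar> \<le> A\<^sup>2 * L"
  proof -
    have "\<bar>?q\<bar> \<le> A\<^sup>2 * L * 1"
      unfolding abs_mult using L1 profile_bound by (intro mult_mono) auto
    then show ?thesis by simp
  qed
  have A2: "A\<^sup>2 \<le> 2 * \<epsilon> * \<bar>A\<bar>"
    using mult_right_mono[OF A_le, of "\<bar>A\<bar>"] by (simp add: power2_eq_square)
  \<comment> \<open>Makes the profile correction at most |A|, so that the sum bounded by 4|A| below
    splits as 2 + 1 + 1.\<close>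
  have A2L: "A\<^sup>2 * L \<le> \<bar>A\<bar>"
  proof -
    have "A\<^sup>2 * L \<le> 2 * \<epsilon> * \<bar>A\<bar> * L" using A2 L1 by (intro mult_right_mono) auto
    also have "\<dots> = (2 * L * \<epsilon>) * \<bar>A\<bar>" by simp
    also have "\<dots> \<le> 1 * \<bar>A\<bar>" by (rule mult_right_mono) (use eps eps0 L1 in auto)
    finally show ?thesis by simp
  qed
  have "\<bar>?q\<^sup>2\<bar> \<le> (A\<^sup>2 * L)\<^sup>2" using q by (metis abs_ge_zero abs_power2 power2_abs power_mono)
  also have "\<dots> = L\<^sup>2 * (A\<^sup>2 * A\<^sup>2)" by (simp add: power2_eq_square)
  also have "\<dots> \<le> L\<^sup>2 * (A\<^sup>2 * (2 * \<epsilon> * \<bar>A\<bar>))" using A2 by (intro mult_left_mono) auto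
  finally have 2: "\<bar>?q\<^sup>2\<bar> \<le> 2 * L\<^sup>2 * (\<epsilon> * \<bar>A\<bar> ^ 3)" by (simp add: A_cubed mult_ac)
  have "\<bar>u t + A * cos t + ?q\<bar> \<le> 4 * \<bar>A\<bar>"
    using amplitude(1)[of t] A_cos[of t] q A2L by linarith
  then have "\<bar>Y t * (u t + A * cos t + ?q)\<bar> \<le> (K3 L * \<epsilon> * A\<^sup>2) * (4 * \<bar>A\<bar>)"
    unfolding abs_mult using Y_bound eps0 by (intro mult_mono) (auto simp: K_nonneg)
  then have 3: "\<bar>Y t * (u t + A * cos t + ?q)\<bar> \<le> 4 * K3 L * (\<epsilon> * \<bar>A\<bar> ^ 3)"
    by (simp add: A_cubed mult_ac)
  have "\<bar>?q\<^sup>2 + Y t * (u t + A * cos t + ?q)\<bar> \<le> (2 * L\<^sup>2 + 4 * K3 L) * (\<epsilon> * \<bar>A\<bar> ^ 3)"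
    using 2 3 unfolding distrib_right by linarith
  then have 4: "\<bar>B * (?q\<^sup>2 + Y t * (u t + A * cos t + ?q))\<bar>
      \<le> L * ((2 * L\<^sup>2 + 4 * K3 L) * (\<epsilon> * \<bar>A\<bar> ^ 3))"
    unfolding abs_mult using L1 by (intro mult_mono) auto
  have "\<bar>(u t)\<^sup>2\<bar> \<le> 4 * A\<^sup>2"
    using power_mono[OF amplitude(1)[of t] abs_ge_zero, of 2] by (simp add: power_mult_distrib)
  moreover have "\<bar>(A * cos t)\<^sup>2\<bar> \<le> A\<^sup>2"
    using power_mono[OF A_cos[of t] abs_ge_zero, of 2] by simp
  moreover have "\<bar>u t * (A * cos t)\<bar> \<le> (2 * \<bar>A\<bar>) * \<bar>A\<bar>"
    unfolding abs_mult[of "u t"] using amplitude(1)[of t] A_cos[of t] by (intro mult_mono) auto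
  moreover have "(2 * \<bar>A\<bar>) * \<bar>A\<bar> = 2 * A\<^sup>2" by (simp add: power2_eq_square)
  ultimately have "\<bar>(u t)\<^sup>2 + u t * (A * cos t) + (A * cos t)\<^sup>2\<bar> \<le> 7 * A\<^sup>2"
    by linarith
  then have "\<bar>C * (y t * ((u t)\<^sup>2 + u t * (A * cos t) + (A * cos t)\<^sup>2))\<bar>
      \<le> L * ((K1 L * A\<^sup>2) * (7 * A\<^sup>2))"
    unfolding abs_mult[of C] abs_mult[of "y t"] using L1 amplitude(3)
    by (intro mult_mono) (auto simp: K_nonneg)
  also have "\<dots> = 7 * L * K1 L * (A\<^sup>2 * A\<^sup>2)" by simp
  also have "\<dots> \<le> 7 * L * K1 L * (A\<^sup>2 * (2 * \<epsilon> * \<bar>A\<bar>))"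
    using A2 L1 by (intro mult_left_mono) (auto simp: K_nonneg)
  finally have 5: "\<bar>C * (y t * ((u t)\<^sup>2 + u t * (A * cos t) + (A * cos t)\<^sup>2))\<bar>
      \<le> 14 * L * K1 L * (\<epsilon> * \<bar>A\<bar> ^ 3)" by (simp add: A_cubed mult_ac)
  \<comment> \<open>Exact splitting into the Taylor remainder, the error in u^2 with u = A cos t + q
    + Y, and the error in u^3 factored as a difference of cubes.\<close>
  have "g t - cubic t = (g t - B * (u t)\<^sup>2 - C * (u t) ^ 3)
      + B * (?q\<^sup>2 + Y t * (u t + A * cos t + ?q))
      + C * (y t * ((u t)\<^sup>2 + u t * (A * cos t) + (A * cos t)\<^sup>2))"
    unfolding cubic_def Y_def y_def
    by (simp add: power2_eq_square power3_eq_cube algebra_simps)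
  then have "\<bar>g t - cubic t\<bar> \<le> 8 * (\<delta> * \<bar>A\<bar> ^ 3)
      + L * ((2 * L\<^sup>2 + 4 * K3 L) * (\<epsilon> * \<bar>A\<bar> ^ 3)) + 14 * L * K1 L * (\<epsilon> * \<bar>A\<bar> ^ 3)"
    using 1 4 5 by linarith
  also have "\<dots> \<le> 8 * (\<delta> * \<bar>A\<bar> ^ 3)
      + L * ((2 * L\<^sup>2 + 4 * K3 L) * (\<delta> * \<bar>A\<bar> ^ 3)) + 14 * L * K1 L * (\<delta> * \<bar>A\<bar> ^ 3)"
    using eps L1 by (intro add_mono mult_left_mono mult_right_mono) (auto simp: K_nonneg)
  also have "\<dots> = K4 L * \<delta> * \<bar>A\<bar> ^ 3" unfolding K4_def by (simp add: algebra_simps)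
  finally show ?thesis .
qed

lemma first_mode_cubic: "first_mode 0 cubic = - (11 / 10 * B\<^sup>2 - 3 / 4 * C) * A ^ 3"
proof -
  have 1: "cont_periodic (\<lambda>t. B * A\<^sup>2 * (cos t * cos t))"
    by (intro cont_periodic_arith cont_periodic_simple)
  have 2: "cont_periodic (\<lambda>t. (2 * B\<^sup>2 * A ^ 3) * (profile t * cos t))"
    by (intro cont_periodic_arith cont_periodic_simple profile_periodic)
  have 3: "cont_periodic (\<lambda>t. (C * A ^ 3) * (cos t * cos t * cos t))"
    by (intro cont_periodic_arith cont_periodic_simple)
  show ?thesis
    unfolding cubic_def[abs_def] first_mode_add(1)[OF cont_periodic_arith(1)[OF 1 2] 3]
      first_mode_add(1)[OF 1 2] first_mode_cmult first_mode_cos_squared first_mode_profile_cos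
      first_mode_cos_cubed
    by (simp add: algebra_simps)
qed

lemma cubic_periodic: "cont_periodic cubic"
  unfolding cubic_def[abs_def] by (intro cont_periodic_arith cont_periodic_simple profile_periodic)

text \<open>The third hypothesis makes the expansion error at most half of the cubic coefficient
  \<kappa>; the fourth keeps the sixth-order terms of X^2 + Z^2 below its fourth-order loss.\<close>

lemma l_ge_1:
  assumes "\<kappa> = 11 / 10 * B\<^sup>2 - 3 / 4 * C" "\<kappa> > 0" "4 * K4 L * \<delta> \<le> \<kappa>"
    and "4 * \<epsilon>\<^sup>2 * (9 / 4 * \<kappa>\<^sup>2 + 4 * (K2 L)\<^sup>2) \<le> \<kappa>"
  shows "l \<ge> 1"
proof -
  define X where "X = A + first_mode 0 g"
  define Z where "Z = first_mode (pi / 2) g"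
  \<comment> \<open>Evaluating at phases s and s + pi/2 puts \<open>g\<close> at phases 0 and pi/2;
    squaring and adding then eliminates \<open>s\<close>.\<close>
  have "A * sin s = l * X" "A * cos s = l * Z"
    using mode_balance[of s] mode_balance[of "s + pi / 2"] unfolding X_def Z_def
    by (simp_all add: sin_add)
  then have "l\<^sup>2 * (X\<^sup>2 + Z\<^sup>2) = (A * sin s)\<^sup>2 + (A * cos s)\<^sup>2"
    by (simp add: power_mult_distrib algebra_simps)
  also have "\<dots> = A\<^sup>2 * ((sin s)\<^sup>2 + (cos s)\<^sup>2)" by (simp only: power_mult_distrib distrib_left)
  finally have norm: "l\<^sup>2 * (X\<^sup>2 + Z\<^sup>2) = A\<^sup>2" by simp
  have Z: "\<bar>Z\<bar> \<le> 2 * (K2 L * \<bar>A\<bar> ^ 3)"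
    unfolding Z_def first_mode_g by (rule first_mode_bound[OF g3_periodic g3_bound])
  have "first_mode 0 (\<lambda>t. g t - cubic t) = X - A + \<kappa> * A ^ 3"
    unfolding first_mode_add(2)[OF g_periodic cubic_periodic] first_mode_cubic X_def assms(1)
    by (simp add: algebra_simps)
  moreover have "\<bar>first_mode 0 (\<lambda>t. g t - cubic t)\<bar> \<le> 2 * (K4 L * \<delta> * \<bar>A\<bar> ^ 3)"
    by (rule first_mode_bound[OF cont_periodic_arith(2)[OF g_periodic cubic_periodic] g_cubic])
  moreover have "4 * K4 L * \<delta> * \<bar>A\<bar> ^ 3 \<le> \<kappa> * \<bar>A\<bar> ^ 3"
    using assms by (intro mult_right_mono) auto
  ultimately have X: "\<bar>X - A + \<kappa> * A ^ 3\<bar> \<le> \<kappa> / 2 * \<bar>A\<bar> ^ 3" by simp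
  \<comment> \<open>The effective cubic coefficient of this orbit, lying between \<kappa>/2 and
    3\<kappa>/2.\<close>
  define \<theta> where "\<theta> = (A - X) / A ^ 3"
  have A0: "A \<noteq> 0" by (rule amplitude(2))
  have XA: "X = A - \<theta> * A ^ 3" unfolding \<theta>_def using A0 by simp
  have "\<bar>\<kappa> - \<theta>\<bar> * \<bar>A\<bar> ^ 3 \<le> \<kappa> / 2 * \<bar>A\<bar> ^ 3"
    using X unfolding XA by (simp add: algebra_simps flip: power_abs abs_mult)
  then have "\<bar>\<kappa> - \<theta>\<bar> \<le> \<kappa> / 2" using A0 by simp
  then have \<theta>: "\<theta> \<ge> \<kappa> / 2" "\<theta> \<le> 3 / 2 * \<kappa>" by linarith+
  have \<theta>2: "\<theta>\<^sup>2 \<le> 9 / 4 * \<kappa>\<^sup>2"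
    using power_mono[OF \<theta>(2), of 2] \<theta>(1) assms(2) by (simp add: power_mult_distrib power2_eq_square)
  have Z2: "Z\<^sup>2 \<le> 4 * (K2 L)\<^sup>2 * A ^ 6"
  proof -
    have "Z\<^sup>2 \<le> (2 * (K2 L * \<bar>A\<bar> ^ 3))\<^sup>2" using power_mono[OF Z, of 2] by simp
    then show ?thesis by (simp add: power_mult_distrib flip: power_mult)
  qed
  have A2: "A\<^sup>2 \<le> 4 * \<epsilon>\<^sup>2"
    using power_mono[OF A_le, of 2] by (simp add: power_mult_distrib)
  have "A\<^sup>2 * (\<theta>\<^sup>2 + 4 * (K2 L)\<^sup>2) \<le> 4 * \<epsilon>\<^sup>2 * (9 / 4 * \<kappa>\<^sup>2 + 4 * (K2 L)\<^sup>2)"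
    using A2 \<theta>2 by (intro mult_mono) auto
  then have key: "A\<^sup>2 * (\<theta>\<^sup>2 + 4 * (K2 L)\<^sup>2) \<le> 2 * \<theta>" using assms(4) \<theta>(1) by linarith
  have "X\<^sup>2 + Z\<^sup>2 \<le> (A - \<theta> * A ^ 3)\<^sup>2 + 4 * (K2 L)\<^sup>2 * A ^ 6" using Z2 XA by simp
  also have "\<dots> = A\<^sup>2 + A ^ 4 * (A\<^sup>2 * (\<theta>\<^sup>2 + 4 * (K2 L)\<^sup>2) - 2 * \<theta>)"
    by (simp add: power2_eq_square eval_nat_numeral algebra_simps)
  also have "\<dots> \<le> A\<^sup>2" using key by (simp add: mult_nonneg_nonpos)
  finally have "l\<^sup>2 * (X\<^sup>2 + Z\<^sup>2) \<le> l\<^sup>2 * A\<^sup>2" by (intro mult_left_mono) auto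
  then have "1 * A\<^sup>2 \<le> l\<^sup>2 * A\<^sup>2" using norm by simp
  then have "1 \<le> l\<^sup>2" using A0 by (simp add: mult_le_cancel_right)
  moreover have "l > 0" using l eps by linarith
  ultimately show ?thesis using abs_square_less_1[of l] by (simp add: not_less)
qed

end

section \<open>Supercriticality and the period\<close>

text \<open>Lagrange remainder of order three, with f''' at the intermediate point replaced by its
  value at 0 by continuity; 6 \<delta> compensates 3!.\<close>

lemma C3_taylor:
  assumes f: "C3 f" "f 0 = 0" "deriv f 0 = 1" and "\<delta> > 0"
  obtains e where "e > 0"
    "\<And>x. \<bar>x\<bar> \<le> e \<Longrightarrow> \<bar>f x - x - coefB f * x\<^sup>2 - coefC f * x ^ 3\<bar> \<le> \<delta> * \<bar>x\<bar> ^ 3"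
proof -
  have "isCont ((deriv ^^ 3) f) 0"
    using f(1) unfolding C3_def by (simp add: continuous_on_eq_continuous_at)
  then obtain d where d: "d > 0" "\<And>t. \<bar>t\<bar> < d \<Longrightarrow> \<bar>(deriv ^^ 3) f t - (deriv ^^ 3) f 0\<bar> < 6 * \<delta>"
    using \<open>\<delta> > 0\<close> unfolding continuous_at_eps_delta dist_real_def
    by (metis diff_zero mult_pos_pos zero_less_numeral)
  have D: "((deriv ^^ m) f has_real_derivative (deriv ^^ Suc m) f t) (at t)" if "m < 3" for m t
  proof -
    have "m = 0 \<or> m = 1 \<or> m = 2" using that by linarith
    then show ?thesis using f(1) by (auto simp: C3_def eval_nat_numeral)
  qed
  show ?thesis
  proof (rule that[of "d / 2"])
    fix x :: real assume x: "\<bar>x\<bar> \<le> d / 2"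
    obtain t where t: "\<bar>t\<bar> \<le> \<bar>x\<bar>" "f x = (\<Sum>m<3. (deriv ^^ m) f 0 / fact m * x ^ m)
        + (deriv ^^ 3) f t / fact 3 * x ^ 3"
      using Maclaurin_bi_le[of "\<lambda>m. (deriv ^^ m) f" f 3 x] D by auto
    have "f x - x - coefB f * x\<^sup>2 - coefC f * x ^ 3
        = ((deriv ^^ 3) f t - (deriv ^^ 3) f 0) / 6 * x ^ 3"
      using f unfolding t(2) coefB_def coefC_def
      by (simp add: eval_nat_numeral algebra_simps diff_divide_distrib)
    moreover have "\<bar>((deriv ^^ 3) f t - (deriv ^^ 3) f 0) / 6\<bar> \<le> \<delta>"
      using d(2)[of t] t(1) x d(1) by (simp add: abs_divide)
    then have "\<bar>((deriv ^^ 3) f t - (deriv ^^ 3) f 0) / 6\<bar> * \<bar>x ^ 3\<bar> \<le> \<delta> * \<bar>x ^ 3\<bar>"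
      by (rule mult_right_mono) simp
    ultimately show "\<bar>f x - x - coefB f * x\<^sup>2 - coefC f * x ^ 3\<bar> \<le> \<delta> * \<bar>x\<bar> ^ 3"
      by (simp only: abs_mult power_abs)
  qed (use d in simp)
qed

lemma C3_continuous: "C3 f \<Longrightarrow> continuous_on UNIV f"
  unfolding C3_def by (meson DERIV_isCont continuous_at_imp_continuous_on)

text \<open>Here \<epsilon> depends on \<open>f\<close> alone, so one choice covers all orbits of a
  branch. The assumption says \<kappa> > 0, since \<kappa> = 3/4 (22/15 B^2 - C).\<close>

lemma small_orbit_delay_ratio:
  assumes f: "C3 f" "f 0 = 0" "deriv f 0 = 1"
    and super: "coefC f < 22 / 15 * (coefB f)\<^sup>2"
  obtains \<epsilon> where "\<epsilon> > 0"
    "\<And>u l s. \<lbrakk>\<And>t. (u has_real_derivative - l * f (u (t - s))) (at t); \<And>t. u (t + 2 * pi) = u t;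
      \<And>t. \<bar>u t\<bar> \<le> \<epsilon>; \<bar>l - 1\<bar> \<le> \<epsilon>; \<bar>s - pi / 2\<bar> \<le> \<epsilon>; \<exists>t. u t \<noteq> 0\<rbrakk> \<Longrightarrow> l \<ge> 1"
proof -
  define B C where "B = coefB f" and "C = coefC f"
  define L where L_eq: "L = 1 + \<bar>B\<bar> + \<bar>C\<bar>"
  define \<kappa> where "\<kappa> = 11 / 10 * B\<^sup>2 - 3 / 4 * C"
  define \<delta> where "\<delta> = min 1 (\<kappa> / (4 * K4 L + 1))"
  define W where "W = 9 / 4 * \<kappa>\<^sup>2 + 4 * (K2 L)\<^sup>2"
  have L1: "L \<ge> 1" unfolding L_eq by simp
  then have K4: "K4 L \<ge> 0" by (simp add: K1_def K2_def K3_def K4_def)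
  have \<kappa>: "\<kappa> > 0" using super unfolding \<kappa>_def B_def C_def by (simp add: field_simps)
  then have \<delta>: "\<delta> > 0" using K4 unfolding \<delta>_def by simp
  have W: "W \<ge> 0" unfolding W_def by simp
  obtain e where e: "e > 0"
    "\<And>x. \<bar>x\<bar> \<le> e \<Longrightarrow> \<bar>f x - x - B * x\<^sup>2 - C * x ^ 3\<bar> \<le> \<delta> * \<bar>x\<bar> ^ 3"
    using C3_taylor[OF f \<delta>] unfolding B_def C_def by blast
  \<comment> \<open>The entries serve, in order, the Taylor range, the linear estimate, the
    absorption, \<epsilon> \<le> \<delta>, and the sixth-order terms. The last is linear in
    \<epsilon> because \<epsilon>^2 \<le> \<epsilon>.\<close>
  define \<epsilon> where "\<epsilon> = Min {e, 1 / 180, 1 / (864 * L), \<delta>, \<kappa> / (4 * W + 1)}"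
  have \<epsilon>: "\<epsilon> > 0" "\<epsilon> \<le> e" "\<epsilon> \<le> 1 / 180" "\<epsilon> \<le> 1 / (864 * L)" "\<epsilon> \<le> \<delta>" "\<epsilon> \<le> \<kappa> / (4 * W + 1)"
  proof -
    show "\<epsilon> > 0" unfolding \<epsilon>_def using e(1) L1 \<delta> \<kappa> W by simp
  qed (unfold \<epsilon>_def, (rule Min_le, simp, simp)+)
  have eL: "864 * L * \<epsilon> \<le> 1" using \<epsilon>(4) L1 by (simp add: field_simps)
  have "\<epsilon>\<^sup>2 \<le> \<epsilon> * 1" unfolding power2_eq_square using \<epsilon> by (intro mult_left_mono) auto
  then have "4 * \<epsilon>\<^sup>2 * W \<le> 4 * (\<epsilon> * 1) * W" using W by (intro mult_right_mono) auto
  moreover have "\<epsilon> * (4 * W + 1) \<le> \<kappa>" using \<epsilon>(6) W by (simp add: field_simps)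
  ultimately have eW: "4 * \<epsilon>\<^sup>2 * W \<le> \<kappa>" using \<epsilon>(1) by (simp add: algebra_simps)
  have "\<delta> \<le> \<kappa> / (4 * K4 L + 1)" by (simp add: \<delta>_def)
  moreover have "4 * K4 L + 1 > 0" using K4 by simp
  ultimately have "\<delta> * (4 * K4 L + 1) \<le> \<kappa>" by (simp only: pos_le_divide_eq)
  then have \<delta>K: "4 * K4 L * \<delta> \<le> \<kappa>" using \<delta> by (simp add: algebra_simps)
  show ?thesis
  proof (rule that[OF \<epsilon>(1)])
    fix u l s
    assume ode: "\<And>t. (u has_real_derivative - l * f (u (t - s))) (at t)"
      and per: "\<And>t. u (t + 2 * pi) = u t" and small: "\<And>t. \<bar>u t\<bar> \<le> \<epsilon>"
      and l: "\<bar>l - 1\<bar> \<le> \<epsilon>" and s: "\<bar>s - pi / 2\<bar> \<le> \<epsilon>" and nz: "\<exists>t. u t \<noteq> 0"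
    have u: "cont_periodic u"
      unfolding cont_periodic_def using per ode
      by (meson DERIV_isCont continuous_at_imp_continuous_on)
    \<comment> \<open>The equation is autonomous, so translating the orbit to normalize its phase is
      harmless.\<close>
    obtain c where c: "first_mode (pi / 2) (\<lambda>t. u (t - c)) = 0"
      by (rule first_mode_zero_translate[OF u])
    interpret small_orbit f "\<lambda>t. u (t - c)" l s B C \<delta> \<epsilon>
      "first_mode 0 (\<lambda>t. u (t - c))" "1 + \<bar>B\<bar> + \<bar>C\<bar>"
    proof unfold_locales
      fix t
      have "((\<lambda>t. u (t - c)) has_real_derivative - l * f (u (t - c - s))) (at t)"
        using ode[of "t - c"] DERIV_shift[of u _ t "- c"] by simp
      then show "((\<lambda>t. u (t - c)) has_real_derivative - l * f (u (t - s - c))) (at t)"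
        by (simp add: algebra_simps)
      obtain r where "u r \<noteq> 0" using nz by blast
      then have "u ((r + c) - c) \<noteq> 0" by simp
      then show "\<exists>t. u (t - c) \<noteq> 0" by (rule exI)
      show "cont_periodic (\<lambda>t. u (t - c))" by (rule cont_periodic_shift'[OF u])
      show "first_mode (pi / 2) (\<lambda>t. u (t - c)) = 0" by (rule c)
      show "\<bar>u (t - c)\<bar> \<le> \<epsilon>" by (rule small)
      show "\<bar>l - 1\<bar> \<le> \<epsilon>" "\<bar>s - pi / 2\<bar> \<le> \<epsilon>" "\<epsilon> \<le> 1 / 180" "\<epsilon> \<le> \<delta>"
        by (rule l s \<epsilon>)+
      show "864 * (1 + \<bar>B\<bar> + \<bar>C\<bar>) * \<epsilon> \<le> 1" using eL unfolding L_eq .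
      show "\<delta> \<le> 1" unfolding \<delta>_def by simp
      show "continuous_on UNIV f" by (rule C3_continuous[OF f(1)])
      show "\<bar>f x - x - B * x\<^sup>2 - C * x ^ 3\<bar> \<le> \<delta> * \<bar>x\<bar> ^ 3" if "\<bar>x\<bar> \<le> \<epsilon>" for x
        by (rule e(2)) (use that \<epsilon>(2) in linarith)
    qed
    show "l \<ge> 1"
      by (rule l_ge_1[OF \<kappa>_def \<kappa> \<delta>K[unfolded L_eq] eW[unfolded W_def L_eq]])
  qed
qed

text \<open>In fact H(k) = 22/15 - 8 / (15 (4k+1) pi).\<close>

lemma H_less: "H k < 22 / 15"
proof -
  define m where "m = (4 * real k + 1) * pi"
  have "m > 0" unfolding m_def by simp
  moreover have "H k = (22 * m - 8) / (15 * m)" by (simp only: H_def m_def mult.assoc)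
  moreover have "(22 * m - 8) / (15 * m) < 22 / 15" using \<open>m > 0\<close> by (simp add: field_simps)
  ultimately show ?thesis by (simp only:)
qed

theorem theorem2:
  fixes f :: "real \<Rightarrow> real" and k :: nat
    and p :: "real \<Rightarrow> real \<Rightarrow> real" and T :: "real \<Rightarrow> real" and \<eta>k :: real
  assumes f_C3: "C3 f" and f0: "f 0 = 0" and f'0: "deriv f 0 = 1"
    and supercrit: "coefC f < H k * (coefB f)\<^sup>2"
    and eta_pos: "\<eta>k > 0"
    and sol: "\<And>\<eta>. 0 < \<eta> \<Longrightarrow> \<eta> < \<eta>k \<Longrightarrow> is_solution f (mu_k k + \<eta>) (p \<eta>)"
    and nonconst: "\<And>\<eta>. 0 < \<eta> \<Longrightarrow> \<eta> < \<eta>k \<Longrightarrow> \<not> (\<exists>c. \<forall>t. p \<eta> t = c)"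
    and per: "\<And>\<eta>. 0 < \<eta> \<Longrightarrow> \<eta> < \<eta>k \<Longrightarrow> minimal_period (p \<eta>) (T \<eta>)"
    and amp: "\<And>\<epsilon>. \<epsilon> > 0 \<Longrightarrow> \<forall>\<^sub>F \<eta> in at_right 0. \<forall>t. \<bar>p \<eta> t\<bar> \<le> \<epsilon>"
    and per_lim: "(T \<longlongrightarrow> 4 / (4 * real k + 1)) (at_right 0)"
  shows "\<forall>\<^sub>F \<eta> in at_right 0. T \<eta> \<ge> 4 / (4 * real k + 1 + 2 * \<eta> / pi)"
proof -
  \<comment> \<open>Scaling the period to 2 pi turns the delay 1 into 2 pi / T. Removing k full
    turns leaves \<open>\<sigma>\<close>, with limit pi/2.\<close>
  define \<sigma> where "\<sigma> \<eta> = 2 * pi / T \<eta> - 2 * pi * real k" for \<eta>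
  define \<rho> where "\<rho> \<eta> = (mu_k k + \<eta>) * T \<eta> / (2 * pi)" for \<eta>
  \<comment> \<open>Only the weak inequality holds in general, as \<open>coefB f\<close> may vanish;
    strictness comes from supercriticality.\<close>
  have "H k * (coefB f)\<^sup>2 \<le> 22 / 15 * (coefB f)\<^sup>2"
    using H_less[of k] by (intro mult_right_mono) auto
  then have super: "coefC f < 22 / 15 * (coefB f)\<^sup>2" using supercrit by linarith
  obtain \<epsilon> where \<epsilon>: "\<epsilon> > 0"
    "\<And>u l s. \<lbrakk>\<And>t. (u has_real_derivative - l * f (u (t - s))) (at t); \<And>t. u (t + 2 * pi) = u t;
      \<And>t. \<bar>u t\<bar> \<le> \<epsilon>; \<bar>l - 1\<bar> \<le> \<epsilon>; \<bar>s - pi / 2\<bar> \<le> \<epsilon>; \<exists>t. u t \<noteq> 0\<rbrakk> \<Longrightarrow> l \<ge> 1"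
    using small_orbit_delay_ratio[OF f_C3 f0 f'0 super] by blast
  have "(\<sigma> \<longlongrightarrow> 2 * pi / (4 / (4 * real k + 1)) - 2 * pi * real k) (at_right 0)"
    unfolding \<sigma>_def by (intro tendsto_intros per_lim) simp
  then have "(\<sigma> \<longlongrightarrow> pi / 2) (at_right 0)" by (simp add: field_simps)
  then have E1: "\<forall>\<^sub>F \<eta> in at_right 0. \<bar>\<sigma> \<eta> - pi / 2\<bar> < \<epsilon>"
    using \<epsilon>(1) by (simp add: tendsto_iff dist_real_def)
  have "(\<rho> \<longlongrightarrow> (mu_k k + 0) * (4 / (4 * real k + 1)) / (2 * pi)) (at_right 0)"
    unfolding \<rho>_def by (intro tendsto_intros per_lim) simp
  moreover have "m * pi / 2 * (4 / m) / (2 * pi) = 1" if "m > 0" for m :: real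
    using that by (simp add: field_simps)
  then have "(mu_k k + 0) * (4 / (4 * real k + 1)) / (2 * pi) = 1"
    unfolding mu_k_def add_0_right by simp
  ultimately have "(\<rho> \<longlongrightarrow> 1) (at_right 0)" by (simp only:)
  then have E2: "\<forall>\<^sub>F \<eta> in at_right 0. \<bar>\<rho> \<eta> - 1\<bar> < \<epsilon>"
    using \<epsilon>(1) by (simp add: tendsto_iff dist_real_def)
  have E3: "\<forall>\<^sub>F \<eta> in at_right 0. 0 < \<eta> \<and> \<eta> < \<eta>k"
    using eventually_at_right_real[OF eta_pos] by (rule eventually_mono) auto
  from E1 E2 E3 amp[OF \<epsilon>(1)] show ?thesis
  proof eventually_elim
    case (elim \<eta>)
    then have \<eta>: "0 < \<eta>" "\<eta> < \<eta>k" by auto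
    define \<mu> where "\<mu> = mu_k k + \<eta>"
    have \<mu>: "\<mu> > 0" using \<eta> unfolding \<mu>_def mu_k_def by (simp add: add_nonneg_pos)
    have T: "T \<eta> > 0" "\<And>t. p \<eta> (t + T \<eta>) = p \<eta> t"
      using per[OF \<eta>] unfolding minimal_period_def by auto
    define u where "u \<theta> = p \<eta> (\<theta> * (T \<eta> / (2 * pi)))" for \<theta>
    have "\<rho> \<eta> \<ge> 1"
    proof (rule \<epsilon>(2))
      fix t
      \<comment> \<open>Undoing the reduction: in original time the two arguments differ by k
        periods.\<close>
      have "(t - \<sigma> \<eta>) * (T \<eta> / (2 * pi)) = (t * (T \<eta> / (2 * pi)) - 1) + of_int (int k) * T \<eta>"
        unfolding \<sigma>_def using T(1) by (simp add: field_simps)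
      then have delay: "u (t - \<sigma> \<eta>) = p \<eta> (t * (T \<eta> / (2 * pi)) - 1)"
        unfolding u_def using periodic_shift_int[of "p \<eta>" "T \<eta>" _ "int k", OF T(2)] by simp
      have "(p \<eta> has_real_derivative - \<mu> * f (p \<eta> (r - 1))) (at r)" for r
        using sol[OF \<eta>] unfolding is_solution_def \<mu>_def by blast
      then have "(u has_real_derivative
          - \<mu> * f (p \<eta> (t * (T \<eta> / (2 * pi)) - 1)) * (T \<eta> / (2 * pi))) (at t)"
        unfolding u_def by (rule DERIV_chain'[rotated]) (auto intro!: derivative_eq_intros)
      then show "(u has_real_derivative - \<rho> \<eta> * f (u (t - \<sigma> \<eta>))) (at t)"
        by (rule DERIV_cong) (simp add: delay \<rho>_def \<mu>_def field_simps)
      have eq: "(t + 2 * pi) * (T \<eta> / (2 * pi)) = t * (T \<eta> / (2 * pi)) + T \<eta>"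
        unfolding distrib_right by simp
      show "u (t + 2 * pi) = u t" unfolding u_def eq by (rule T(2))
      show "\<bar>u t\<bar> \<le> \<epsilon>" unfolding u_def using elim by blast
      show "\<exists>t. u t \<noteq> 0"
      proof (rule ccontr)
        assume "\<not> ?thesis"
        then have "u (r * (2 * pi / T \<eta>)) = 0" for r by blast
        then have "p \<eta> r = 0" for r unfolding u_def using T(1) by simp
        then show False using nonconst[OF \<eta>] by blast
      qed
    qed (use elim in auto)
    \<comment> \<open>The ratio bound says T \<ge> 2 pi / \<mu>, which is the claimed bound once
      \<mu> is expanded.\<close>
    then have "2 * pi \<le> \<mu> * T \<eta>" unfolding \<rho>_def \<mu>_def by (simp add: field_simps)
    then have "2 * pi / \<mu> \<le> T \<eta>" using \<mu> by (simp add: field_simps)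
    moreover have "2 * pi / \<mu> = 4 / (4 * real k + 1 + 2 * \<eta> / pi)"
      unfolding \<mu>_def mu_k_def by (simp add: field_simps)
    ultimately show ?case by simp
  qed
qed

end
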